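(* Fix $n\ge1$, $\tau\in\mathbb H$ and $p\in E_\tau\setminus E_\tau[2]$. For $T\in\mathbb C$ put $N=n(n+1)$, $f_p(z)=\wp(z)-\wp(p)$, $g_p=f_p'/f_p$, $h_p=f_p^{-1/2}$ and $\widetilde B=T^2-N\wp(p)$. Then the first-order operators $$\mathcal D_{p,T}\,y=h_p\,(y'-Ty),\qquad \mathcal E_{p,T}\,v=\frac{h_p}{N}\Bigl(v'+\Bigl(T+\frac{g_p}2\Bigr)v\Bigr)$$ are mutually inverse isomorphisms between the solution spaces of $\mathrm L_n(\widetilde B,\tau)$ and $\mathrm{GLE}^{(1)}_n(p,T,\tau)$ ($\mathcal D_{p,T}$ from the former to the latter). These transformations preserve the period monodromy.
   Context: $E_\tau=\mathbb C/(\mathbb Z+\mathbb Z\tau)$, $\omega_1=1,\omega_2=\tau$; $\wp,\zeta,\sigma$ are the Weierstrass functions. $\mathrm L_n(\widetilde B,\tau)$: $y''=(n(n+1)\wp(z)+\widetilde B)y$. $\mathrm{GLE}^{(1)}_n(p,T,\tau)$: $v''=q^{(1)}_n(z;p,T)v$ with $$q_n^{(1)}=n(n+1)\wp(z)+\tfrac34(\wp(z+p)+\wp(z-p))+T(\zeta(z+p)+\zeta(z-p)-2\zeta(z))-\tfrac{\wp''(p)}{4\wp'(p)}(\zeta(z+p)-\zeta(z-p))+B,$$ $B=T^2+\frac{\wp''(p)}{2\wp'(p)}\zeta(p)-\frac12(2n^2+2n-3)\wp(p)$. The same branch of $h_p=f_p^{-1/2}$ is used in both operators. Period monodromy is taken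 along cycles $\ell_j$ ($z\to z+\omega_j$, $j=1,2$), avoiding $0,\pm p$, chosen so that the continuation of $\Psi_p(z)=\sigma(z)/\sqrt{\sigma(z-p)\sigma(z+p)}$ (a constant multiple of $h_p$) along $\ell_j$ satisfies $\Psi_p(z+\omega_j)=\Psi_p(z)$. Preserving the period monodromy means that a fundamental system and its image have the same monodromy matrices $M_1,M_2$ along $\ell_1,\ell_2$. *)

theory Defs
  imports "HOL-Complex_Analysis.Complex_Analysis"
begin

definition lattice :: "complex \<Rightarrow> complex set" where
  "lattice \<tau> = {of_int a + of_int b * \<tau> | a b :: int. True}"

text \<open>The values of \<open>wp\<close> and \<open>wzeta\<close> at lattice points (their poles) are meaningless and never used.\<close>

definition wp :: "complex \<Rightarrow> complex \<Rightarrow> complex" where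
  "wp \<tau> z = 1 / z^2 + (\<Sum>\<^sub>\<infinity>\<omega>\<in>lattice \<tau> - {0}. 1 / (z - \<omega>)^2 - 1 / \<omega>^2)"

definition wzeta :: "complex \<Rightarrow> complex \<Rightarrow> complex" where
  "wzeta \<tau> z = 1 / z + (\<Sum>\<^sub>\<infinity>\<omega>\<in>lattice \<tau> - {0}. 1 / (z - \<omega>) + 1 / \<omega> + z / \<omega>^2)"

text \<open>The unordered infinite product, i.e. the limit over finite subsets of the index set, as
  in the definition of \<^const>\<open>infsum\<close>.\<close>

definition wsigma :: "complex \<Rightarrow> complex \<Rightarrow> complex" where
  "wsigma \<tau> z = z * Lim (finite_subsets_at_top (lattice \<tau> - {0}))
     (\<lambda>F. \<Prod>\<omega>\<in>F. (1 - z / \<omega>) * exp (z / \<omega> + z^2 / (2 * \<omega>^2)))"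

definition lame_potential :: "nat \<Rightarrow> complex \<Rightarrow> complex \<Rightarrow> complex \<Rightarrow> complex" where
  "lame_potential n B \<tau> z = of_nat (n * (n + 1)) * wp \<tau> z + B"

definition gle_constant :: "nat \<Rightarrow> complex \<Rightarrow> complex \<Rightarrow> complex \<Rightarrow> complex" where
  "gle_constant n p T \<tau> =
     T^2 + (deriv ^^ 2) (wp \<tau>) p / (2 * deriv (wp \<tau>) p) * wzeta \<tau> p
       - 1/2 * (2 * of_nat n ^ 2 + 2 * of_nat n - 3) * wp \<tau> p"

definition gle_potential :: "nat \<Rightarrow> complex \<Rightarrow> complex \<Rightarrow> complex \<Rightarrow> complex \<Rightarrow> complex" where
  "gle_potential n p T \<tau> z =
     of_nat (n * (n + 1)) * wp \<tau> z
     + 3/4 * (wp \<tau> (z + p) + wp \<tau> (z - p))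
     + T * (wzeta \<tau> (z + p) + wzeta \<tau> (z - p) - 2 * wzeta \<tau> z)
     - (deriv ^^ 2) (wp \<tau>) p / (4 * deriv (wp \<tau>) p) * (wzeta \<tau> (z + p) - wzeta \<tau> (z - p))
     + gle_constant n p T \<tau>"

definition singular_points :: "complex \<Rightarrow> complex \<Rightarrow> complex set" where
  "singular_points \<tau> p = {z. z \<in> lattice \<tau> \<or> z - p \<in> lattice \<tau> \<or> z + p \<in> lattice \<tau>}"

text \<open>Single-valued solutions of \<open>y'' = q y\<close> on the domain \<open>U\<close>. Extending them by zero
  makes equality of functions coincide with equality on \<open>U\<close>.\<close>

definition solution_space :: "(complex \<Rightarrow> complex) \<Rightarrow> complex set \<Rightarrow> (complex \<Rightarrow> complex) set" where
  "solution_space q U =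
     {y. y holomorphic_on U \<and> (\<forall>z\<in>U. (deriv ^^ 2) y z = q z * y z) \<and> (\<forall>z. z \<notin> U \<longrightarrow> y z = 0)}"

definition complex_linear_on ::
  "(complex \<Rightarrow> complex) set \<Rightarrow> ((complex \<Rightarrow> complex) \<Rightarrow> (complex \<Rightarrow> complex)) \<Rightarrow> bool" where
  "complex_linear_on V D \<longleftrightarrow>
     (\<forall>y\<^sub>1\<in>V. \<forall>y\<^sub>2\<in>V. \<forall>a b.
        D (\<lambda>z. a * y\<^sub>1 z + b * y\<^sub>2 z) = (\<lambda>z. a * D y\<^sub>1 z + b * D y\<^sub>2 z))"

definition mutually_inverse_isomorphisms ::
  "(complex \<Rightarrow> complex) set \<Rightarrow> (complex \<Rightarrow> complex) set \<Rightarrow>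
   ((complex \<Rightarrow> complex) \<Rightarrow> (complex \<Rightarrow> complex)) \<Rightarrow>
   ((complex \<Rightarrow> complex) \<Rightarrow> (complex \<Rightarrow> complex)) \<Rightarrow> bool" where
  "mutually_inverse_isomorphisms V W D E \<longleftrightarrow>
     D \<in> V \<rightarrow> W \<and> E \<in> W \<rightarrow> V \<and>
     complex_linear_on V D \<and> complex_linear_on W E \<and>
     (\<forall>y\<in>V. E (D y) = y) \<and> (\<forall>v\<in>W. D (E v) = v)"

definition f_fun :: "complex \<Rightarrow> complex \<Rightarrow> complex \<Rightarrow> complex" where
  "f_fun \<tau> p z = wp \<tau> z - wp \<tau> p"

definition g_fun :: "complex \<Rightarrow> complex \<Rightarrow> complex \<Rightarrow> complex" where
  "g_fun \<tau> p z = deriv (f_fun \<tau> p) z / f_fun \<tau> p z"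

text \<open>\<open>h\<close> is a holomorphic branch of \<open>f\<^sub>p\<close> to the power \<open>-1/2\<close> on \<open>U\<close>.\<close>

definition h_branch :: "complex \<Rightarrow> complex \<Rightarrow> complex set \<Rightarrow> (complex \<Rightarrow> complex) \<Rightarrow> bool" where
  "h_branch \<tau> p U h \<longleftrightarrow> h holomorphic_on U \<and> (\<forall>z\<in>U. h z ^ 2 = 1 / f_fun \<tau> p z)"

definition op_D ::
  "complex \<Rightarrow> complex set \<Rightarrow> (complex \<Rightarrow> complex) \<Rightarrow> (complex \<Rightarrow> complex) \<Rightarrow> complex \<Rightarrow> complex" where
  "op_D T U h y = (\<lambda>z. if z \<in> U then h z * (deriv y z - T * y z) else 0)"

definition op_E ::
  "nat \<Rightarrow> complex \<Rightarrow> complex \<Rightarrow> complex \<Rightarrow> complex set \<Rightarrow> (complex \<Rightarrow> complex) \<Rightarrow>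
   (complex \<Rightarrow> complex) \<Rightarrow> complex \<Rightarrow> complex" where
  "op_E n \<tau> p T U h v =
     (\<lambda>z. if z \<in> U
        then h z / of_nat (n * (n + 1)) * (deriv v z + (T + g_fun \<tau> p z / 2) * v z) else 0)"

text \<open>The germ of \<open>f\<close> at the start of \<open>\<gamma>\<close> continues analytically along \<open>\<gamma>\<close> to the germ of \<open>f'\<close>
  at its end; \<open>F t\<close> represents the germ at \<open>\<gamma> t\<close>.\<close>

definition continues_along ::
  "(real \<Rightarrow> complex) \<Rightarrow> (complex \<Rightarrow> complex) \<Rightarrow> (complex \<Rightarrow> complex) \<Rightarrow> bool" where
  "continues_along \<gamma> f f' \<longleftrightarrow>
     (\<exists>F :: real \<Rightarrow> complex \<Rightarrow> complex.
        (\<forall>t\<in>{0..1}. F t analytic_on {\<gamma> t}) \<and>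
        (\<forall>t\<in>{0..1}. \<exists>e>0. \<forall>s\<in>{0..1}. \<bar>s - t\<bar> < e \<longrightarrow>
           (\<forall>\<^sub>F z in nhds (\<gamma> s). F s z = F t z)) \<and>
        (\<forall>\<^sub>F z in nhds (pathstart \<gamma>). F 0 z = f z) \<and>
        (\<forall>\<^sub>F z in nhds (pathfinish \<gamma>). F 1 z = f' z))"

definition Psi_branch :: "complex \<Rightarrow> complex \<Rightarrow> complex set \<Rightarrow> (complex \<Rightarrow> complex) \<Rightarrow> bool" where
  "Psi_branch \<tau> p W \<psi> \<longleftrightarrow>
     (\<exists>r. r holomorphic_on W \<and>
          (\<forall>z\<in>W. r z ^ 2 = wsigma \<tau> (z - p) * wsigma \<tau> (z + p) \<and> \<psi> z = wsigma \<tau> z / r z))"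

text \<open>A lift to the plane of a cycle \<open>z \<rightarrow> z + \<omega>\<close>. The condition on \<open>\<Psi>\<^sub>p\<close> does
  not depend on which of its two branches at the base point is taken.\<close>

definition admissible_cycle :: "complex \<Rightarrow> complex \<Rightarrow> complex \<Rightarrow> (real \<Rightarrow> complex) \<Rightarrow> bool" where
  "admissible_cycle \<tau> p \<omega> \<gamma> \<longleftrightarrow>
     path \<gamma> \<and> pathfinish \<gamma> = pathstart \<gamma> + \<omega> \<and>
     path_image \<gamma> \<inter> singular_points \<tau> p = {} \<and>
     (\<exists>W \<psi> \<psi>'. open W \<and> pathstart \<gamma> \<in> W \<and> Psi_branch \<tau> p W \<psi> \<and>
        continues_along \<gamma> \<psi> \<psi>' \<and>
        (\<forall>\<^sub>F z in nhds (pathstart \<gamma>). \<psi>' (z + \<omega>) = \<psi> z))"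

text \<open>An ordered basis of a (two-dimensional) solution space.\<close>

definition fundamental_system ::
  "(complex \<Rightarrow> complex) set \<Rightarrow> (2 \<Rightarrow> complex \<Rightarrow> complex) \<Rightarrow> bool" where
  "fundamental_system V Y \<longleftrightarrow>
     (\<forall>i. Y i \<in> V) \<and>
     (\<forall>y\<in>V. \<exists>!c :: complex ^ 2. y = (\<lambda>z. \<Sum>i\<in>UNIV. c $ i * Y i z))"

text \<open>\<open>(y\<^sub>1, y\<^sub>2)(z + \<omega>) = (y\<^sub>1, y\<^sub>2)(z) M\<close>, where the left-hand side is
  continued along \<open>\<gamma>\<close>.\<close>

definition monodromy_matrix ::
  "(real \<Rightarrow> complex) \<Rightarrow> complex \<Rightarrow> (2 \<Rightarrow> complex \<Rightarrow> complex) \<Rightarrow> complex ^ 2 ^ 2 \<Rightarrow> bool" where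
  "monodromy_matrix \<gamma> \<omega> Y M \<longleftrightarrow>
     (\<exists>Y'. (\<forall>i. continues_along \<gamma> (Y i) (Y' i)) \<and>
           (\<forall>\<^sub>F z in nhds (pathstart \<gamma>).
              (\<chi> j. Y' j (z + \<omega>)) = (\<chi> i. Y i z) v* M))"

definition preserves_period_monodromy ::
  "complex \<Rightarrow> complex \<Rightarrow> complex set \<Rightarrow> (complex \<Rightarrow> complex) set \<Rightarrow>
   ((complex \<Rightarrow> complex) \<Rightarrow> (complex \<Rightarrow> complex)) \<Rightarrow> bool" where
  "preserves_period_monodromy \<tau> p U V D \<longleftrightarrow>
     (\<forall>Y. fundamental_system V Y \<longrightarrow>
        (\<forall>\<omega>\<in>{1, \<tau>}. \<forall>\<gamma>. admissible_cycle \<tau> p \<omega> \<gamma> \<and> pathstart \<gamma> \<in> U \<longrightarrow>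
           (\<forall>M. monodromy_matrix \<gamma> \<omega> Y M \<longleftrightarrow> monodromy_matrix \<gamma> \<omega> (\<lambda>i. D (Y i)) M)))"

end

theory Submission
  imports Defs
begin

text \<open>
  Put \<open>k = T + g/2\<close>. Since \<open>h' = - (g/2) h\<close>, \<open>h\<^sup>2 f = 1\<close> and the Lame equation reads
  \<open>y'' = (N f + T\<^sup>2) y\<close>, the function \<open>v = h (y' - T y)\<close> satisfies \<open>v' + k v = N h f y\<close>. Hence
  \<open>E v = y\<close>, and a second differentiation gives \<open>v'' = (N f + k\<^sup>2 - g'/2) v\<close>. That this potential is
  the stated one amounts to the addition formula \<open>g = \<zeta>(z + p) + \<zeta>(z - p) - 2 \<zeta>(z)\<close>, the same formula
  with \<open>z\<close> and \<open>p\<close> exchanged, and \<open>\<wp>'' = 6 \<wp>\<^sup>2 + const\<close>; all three follow from Liouville's theorem.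
  Comparing orders in \<open>f' = g f\<close>, with \<open>g\<close> given by the \<open>\<zeta>\<close> formula, shows that \<open>f\<close> vanishes only at
  \<open>\<plusminus>p\<close> modulo the lattice, and there to first order, so that \<open>\<wp>'(p) \<noteq> 0\<close>.

  For the monodromy, \<open>\<Psi>\<close> and \<open>h\<close> have the same logarithmic derivative \<open>- g/2\<close>, so \<open>h\<close> continues to
  itself along an admissible cycle. As \<open>g\<close> is elliptic, both operators commute with the
  continuation, and they are inverse to each other.
\<close>

section \<open>Lattice sums\<close>

text \<open>With \<open>v = D y\<close>, the pair satisfies the first-order system
  \<open>y' = T y + h f v\<close>, \<open>v' = N h f y - (T + g/2) v\<close>, where
  \<open>h f = 1/h\<close>. Eliminating \<open>v\<close> gives the Lame equation, eliminating
  \<open>y\<close> gives the other one. Solving the two lines for \<open>v\<close> and for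
  \<open>y\<close> gives \<open>D\<close> and \<open>E\<close>, which is why these are inverse to
  each other and where the factor \<open>1/N\<close> comes from. The constant \<open>B\<close> is
  what the elimination produces: its zeta term cancels the constant part of the zeta difference, and
  its \<open>3/2 wp(p)\<close> balances what remains of the \<open>wp\<close> terms.

  The obstacle is that \<open>wp\<close> and \<open>wzeta\<close> have arbitrary values at their
  poles. Liouville's theorem is therefore applied to functions that are controlled only on punctured
  neighbourhoods, and its conclusion holds there first. The addition formula is proved in the form
  multiplied by \<open>f\<close>, because the zeros of \<open>f\<close> become known only
  afterwards, as a consequence of that formula.\<close>

lemma lattice_0 [simp]: "0 \<in> lattice \<tau>"
  unfolding lattice_def by (auto intro!: exI[of _ 0])

lemma lattice_1: "1 \<in> lattice \<tau>"
proof -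
  have "1 = of_int 1 + of_int 0 * \<tau>" by simp
  then show ?thesis unfolding lattice_def by blast
qed

lemma lattice_tau: "\<tau> \<in> lattice \<tau>"
proof -
  have "\<tau> = of_int 0 + of_int 1 * \<tau>" by simp
  then show ?thesis unfolding lattice_def by blast
qed

lemma lattice_add: "x \<in> lattice \<tau> \<Longrightarrow> y \<in> lattice \<tau> \<Longrightarrow> x + y \<in> lattice \<tau>"
  unfolding lattice_def
proof clarify
  fix a b c d :: int
  show "\<exists>a' b'. of_int a + of_int b * \<tau> + (of_int c + of_int d * \<tau>) = of_int a' + of_int b' * \<tau> \<and> True"
    by (intro exI[of _ "a + c"] exI[of _ "b + d"]) (simp add: algebra_simps)
qed

lemma lattice_uminus: "x \<in> lattice \<tau> \<Longrightarrow> - x \<in> lattice \<tau>"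
  unfolding lattice_def
proof clarify
  fix a b :: int
  show "\<exists>a' b'. - (of_int a + of_int b * \<tau>) = of_int a' + of_int b' * \<tau> \<and> True"
    by (intro exI[of _ "- a"] exI[of _ "- b"]) (simp add: algebra_simps)
qed

lemma lattice_uminus_iff [simp]: "- x \<in> lattice \<tau> \<longleftrightarrow> x \<in> lattice \<tau>"
  using lattice_uminus[of x] lattice_uminus[of "- x"] by auto

lemma lattice_diff: "x \<in> lattice \<tau> \<Longrightarrow> y \<in> lattice \<tau> \<Longrightarrow> x - y \<in> lattice \<tau>"
  using lattice_add[of x \<tau> "- y"] by simp

lemma lattice_add_iff: "\<alpha> \<in> lattice \<tau> \<Longrightarrow> x + \<alpha> \<in> lattice \<tau> \<longleftrightarrow> x \<in> lattice \<tau>"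
  using lattice_add[of x \<tau> \<alpha>] lattice_diff[of "x + \<alpha>" \<tau> \<alpha>] by auto

lemma bij_betw_lattice_shift: "\<alpha> \<in> lattice \<tau> \<Longrightarrow> bij_betw (\<lambda>\<omega>. \<omega> + \<alpha>) (lattice \<tau>) (lattice \<tau>)"
  by (rule bij_betwI[where g = "\<lambda>\<omega>. \<omega> - \<alpha>"]) (auto intro: lattice_add lattice_diff)

lemma bij_betw_lattice_uminus: "bij_betw uminus (lattice \<tau>) (lattice \<tau>)"
  by (rule bij_betwI[where g = uminus]) auto

text \<open>The imaginary part of the lattice point is \<open>b * Im \<tau>\<close>, which controls
  \<open>b\<close>; the triangle inequality then controls \<open>a\<close>. The constant
  \<open>K\<close> adds up both factors so that one bound serves both coordinates.\<close>

lemma lattice_coordinates_bound: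
  assumes "Im \<tau> > 0"
  obtains K where "K > 0"
    "\<And>a b :: int. \<bar>real_of_int a\<bar> \<le> K * norm (of_int a + of_int b * \<tau>)"
    "\<And>a b :: int. \<bar>real_of_int b\<bar> \<le> K * norm (of_int a + of_int b * \<tau>)"
proof -
  define K where "K = 1 + norm \<tau> / Im \<tau> + 1 / Im \<tau>"
  have K: "K > 0" using assms unfolding K_def by (intro add_pos_nonneg) auto
  have b: "\<bar>real_of_int b\<bar> \<le> norm (of_int a + of_int b * \<tau>) / Im \<tau>" for a b :: int
  proof -
    have "\<bar>real_of_int b\<bar> * Im \<tau> = \<bar>Im (of_int a + of_int b * \<tau>)\<bar>"
      using assms by (simp add: abs_mult)
    also have "\<dots> \<le> norm (of_int a + of_int b * \<tau>)" by (rule abs_Im_le_cmod)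
    finally show ?thesis using assms by (simp add: field_simps)
  qed
  have a: "\<bar>real_of_int a\<bar> \<le> norm (of_int a + of_int b * \<tau>) * (1 + norm \<tau> / Im \<tau>)" for a b :: int
  proof -
    have "\<bar>real_of_int a\<bar> = norm ((of_int a + of_int b * \<tau>) - of_int b * \<tau>)" by simp
    also have "\<dots> \<le> norm (of_int a + of_int b * \<tau>) + norm (of_int b * \<tau>)"
      by (rule norm_triangle_ineq4)
    also have "norm (of_int b * \<tau>) \<le> norm (of_int a + of_int b * \<tau>) / Im \<tau> * norm \<tau>"
      using mult_right_mono[OF b[of b a], of "norm \<tau>"] by (simp add: norm_mult)
    finally show ?thesis by (simp add: algebra_simps)
  qed
  show ?thesis
  proof
    fix a b :: int
    let ?x = "norm (of_int a + of_int b * \<tau>)"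
    have "?x * (1 + norm \<tau> / Im \<tau>) \<le> ?x * K" "?x * (1 / Im \<tau>) \<le> ?x * K"
      using assms unfolding K_def by (intro mult_left_mono; simp)+
    then show "\<bar>real_of_int a\<bar> \<le> K * ?x" "\<bar>real_of_int b\<bar> \<le> K * ?x"
      using a[of a b] b[of b a] by (simp_all add: mult.commute)
  qed (fact K)
qed

text \<open>The exponent 3/2 is half of the exponent 3 of the lattice sum and still exceeds 1. The
  integers are covered by two copies of the naturals.\<close>

lemma summable_on_int_powr: "(\<lambda>a::int. (1 + \<bar>real_of_int a\<bar>) powr (-3/2)) summable_on UNIV"
proof -
  let ?f = "\<lambda>a::int. (1 + \<bar>real_of_int a\<bar>) powr (-3/2)"
  have "summable (\<lambda>n. real (Suc n) powr (-3/2))"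
    using summable_real_powr_iff[of "-3/2"] by (subst summable_Suc_iff) auto
  then have s: "(\<lambda>n. (1 + real n) powr (-3/2)) summable_on UNIV"
    by (subst summable_on_UNIV_nonneg_real_iff) (auto simp: add.commute)
  have "?f summable_on range int" "?f summable_on range (\<lambda>n. - int n)"
    by (subst summable_on_reindex; use s in \<open>auto simp: o_def inj_on_def\<close>)+
  then have "?f summable_on (range int \<union> range (\<lambda>n. - int n))"
    by (rule summable_on_union)
  also have "range int \<union> range (\<lambda>n. - int n) = UNIV"
    by (auto simp: image_def) (metis int_cases2)
  finally show ?thesis .
qed

text \<open>For \<open>\<omega> = a + b \<tau> \<noteq> 0\<close>, both \<open>1 + \<bar>a\<bar>\<close> and \<open>1 + \<bar>b\<bar>\<close> are \<open>O(\<bar>\<omega>\<bar>)\<close>, so \<open>1 / \<bar>\<omega>\<bar>\<^sup>3\<close> is dominated by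
  the product of \<open>(1 + \<bar>a\<bar>) powr (-3/2)\<close> and \<open>(1 + \<bar>b\<bar>) powr (-3/2)\<close>.\<close>

lemma summable_on_lattice:
  assumes "Im \<tau> > 0"
  shows "(\<lambda>\<omega>. 1 / norm \<omega> ^ 3) summable_on lattice \<tau>"
proof -
  obtain K where K: "K > 0"
    "\<And>a b :: int. \<bar>real_of_int a\<bar> \<le> K * norm (of_int a + of_int b * \<tau>)"
    "\<And>a b :: int. \<bar>real_of_int b\<bar> \<le> K * norm (of_int a + of_int b * \<tau>)"
    using lattice_coordinates_bound[OF assms] by blast
  define w where "w = (\<lambda>(a, b). of_int a + of_int b * \<tau> :: complex)"
  define u where "u = (\<lambda>a::int. (1 + \<bar>real_of_int a\<bar>) powr (-3/2))"
  have u: "u summable_on UNIV" unfolding u_def by (rule summable_on_int_powr)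
  have u0: "u a \<ge> 0" for a by (simp add: u_def)
  have "((\<lambda>y. u x * u y) has_sum (u x * infsum u UNIV)) UNIV" for x
    using u by (intro has_sum_cmult_right) (simp add: summable_iff_has_sum_infsum)
  then have "(\<lambda>(a, b). u a * u b) summable_on Sigma UNIV (\<lambda>_. UNIV)"
    by (intro summable_on_SigmaI[where g = "\<lambda>x. u x * infsum u UNIV"])
       (auto intro!: summable_on_cmult_left u mult_nonneg_nonneg u0)
  then have "(\<lambda>ab. (2 * K) ^ 3 * (case ab of (a, b) \<Rightarrow> u a * u b)) summable_on UNIV"
    by (intro summable_on_cmult_right) simp
  then have s: "(\<lambda>ab. 1 / norm (w ab) ^ 3) summable_on UNIV"
  proof (rule summable_on_comparison_test)
    fix ab :: "int \<times> int"
    obtain a b where ab: "ab = (a, b)" by force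
    show "1 / norm (w ab) ^ 3 \<le> (2 * K) ^ 3 * (case ab of (a, b) \<Rightarrow> u a * u b)"
    proof (cases "w ab = 0")
      case True
      then show ?thesis using u0 K(1) by (simp add: ab)
    next
      case False
      define x where "x = norm (w ab)"
      have x: "x > 0" using False by (simp add: x_def)
      have wab: "norm (of_int a + of_int b * \<tau>) = x" by (simp add: x_def w_def ab)
      \<comment> \<open>A nonzero point has a nonzero integer coordinate; this absorbs the summand 1
        in \<open>1 + \<bar>a\<bar>\<close> at the cost of a factor 2.\<close>
      have ge1: "K * x \<ge> 1"
      proof -
        have "a \<noteq> 0 \<or> b \<noteq> 0" using False by (auto simp: w_def ab)
        then have "\<bar>real_of_int a\<bar> \<ge> 1 \<or> \<bar>real_of_int b\<bar> \<ge> 1" by linarith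
        with K(2)[of a b] K(3)[of b a] show ?thesis unfolding wab by linarith
      qed
      have b1: "1 + \<bar>real_of_int a\<bar> \<le> 2 * K * x" "1 + \<bar>real_of_int b\<bar> \<le> 2 * K * x"
        using K(2)[of a b] K(3)[of b a] ge1 unfolding wab by linarith+
      have "(2 * K * x) powr (-3/2) \<le> u a" "(2 * K * x) powr (-3/2) \<le> u b"
        unfolding u_def using b1 by (intro powr_mono2'; simp)+
      then have "(2 * K * x) powr (-3/2) * (2 * K * x) powr (-3/2) \<le> u a * u b"
        by (intro mult_mono) (auto simp: u0)
      also have "(2 * K * x) powr (-3/2) * (2 * K * x) powr (-3/2) = 1 / (2 * K * x) ^ 3"
        using K x by (simp flip: powr_add add: powr_minus powr_numeral divide_simps)
      finally have "1 / ((2 * K) ^ 3 * x ^ 3) \<le> u a * u b" by (simp add: power_mult_distrib)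
      then have "1 / x ^ 3 \<le> (2 * K) ^ 3 * (u a * u b)" using K(1) x by (simp add: field_simps)
      then show ?thesis by (simp add: x_def ab)
    qed
  qed auto
  \<comment> \<open>The coordinate bounds, applied to the lattice point 0, force both coordinate
    differences to vanish.\<close>
  have inj: "inj_on w UNIV"
  proof (rule inj_onI, clarify)
    fix a b c d :: int
    assume "w (a, b) = w (c, d)"
    then have e: "of_int (a - c) + of_int (b - d) * \<tau> = 0" by (simp add: w_def algebra_simps)
    show "a = c \<and> b = d"
      using K(2)[of "a - c" "b - d"] K(3)[of "b - d" "a - c"] unfolding e by simp
  qed
  have "lattice \<tau> = range w" by (auto simp: lattice_def w_def)
  then show ?thesis using summable_on_reindex[OF inj, of "\<lambda>\<omega>. 1 / norm \<omega> ^ 3"] s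
    by (simp add: o_def)
qed

lemma finite_lattice_cball:
  assumes "Im \<tau> > 0"
  shows "finite {\<omega> \<in> lattice \<tau>. norm \<omega> \<le> R}"
proof -
  obtain K where K: "K > 0"
    "\<And>a b :: int. \<bar>real_of_int a\<bar> \<le> K * norm (of_int a + of_int b * \<tau>)"
    "\<And>a b :: int. \<bar>real_of_int b\<bar> \<le> K * norm (of_int a + of_int b * \<tau>)"
    using lattice_coordinates_bound[OF assms] by blast
  define m where "m = \<lceil>K * R\<rceil>"
  have "{\<omega> \<in> lattice \<tau>. norm \<omega> \<le> R} \<subseteq> (\<lambda>(a, b). of_int a + of_int b * \<tau>) ` ({-m..m} \<times> {-m..m})"
  proof clarify
    fix \<omega> assume "\<omega> \<in> lattice \<tau>" and R: "norm \<omega> \<le> R"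
    then obtain a b :: int where w: "\<omega> = of_int a + of_int b * \<tau>" by (auto simp: lattice_def)
    have "K * norm \<omega> \<le> K * R" using K R by simp
    then have "\<bar>real_of_int a\<bar> \<le> K * R" "\<bar>real_of_int b\<bar> \<le> K * R"
      using K(2)[of a b] K(3)[of b a] by (auto simp: w)
    then have "a \<in> {-m..m}" "b \<in> {-m..m}" unfolding m_def by (auto simp: abs_le_iff) linarith+
    then show "\<omega> \<in> (\<lambda>(a, b). of_int a + of_int b * \<tau>) ` ({-m..m} \<times> {-m..m})"
      by (intro image_eqI[of _ _ "(a, b)"]) (auto simp: w)
  qed
  then show ?thesis by (rule finite_subset) auto
qed

text \<open>Subtracting the floors of the real coordinates with respect to 1 and \<tau> leaves
  fractional parts. The uniform bound is the compactness needed for Liouville's theorem.\<close>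

lemma lattice_representative:
  assumes "Im \<tau> > 0"
  obtains \<alpha> where "\<alpha> \<in> lattice \<tau>" "norm (z + \<alpha>) \<le> 1 + norm \<tau>"
proof -
  define y where "y = Im z / Im \<tau>"
  define x where "x = Re z - y * Re \<tau>"
  have z: "z = of_real x + of_real y * \<tau>"
    using assms by (simp add: complex_eq_iff x_def y_def)
  define \<alpha> where "\<alpha> = - (of_int \<lfloor>x\<rfloor> + of_int \<lfloor>y\<rfloor> * \<tau>)"
  have "\<alpha> \<in> lattice \<tau>" unfolding \<alpha>_def lattice_uminus_iff by (auto simp: lattice_def)
  moreover have "norm (z + \<alpha>) \<le> 1 + norm \<tau>"
  proof -
    have "z + \<alpha> = of_real (frac x) + of_real (frac y) * \<tau>"
      by (simp add: z \<alpha>_def frac_def algebra_simps)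
    then have "norm (z + \<alpha>) \<le> frac x + frac y * norm \<tau>"
      by (metis abs_of_nonneg frac_ge_0 norm_mult norm_of_real norm_triangle_ineq)
    also have "frac x \<le> 1" using frac_lt_1[of x] by simp
    also have "frac y * norm \<tau> \<le> 1 * norm \<tau>"
      using frac_lt_1[of y] by (intro mult_right_mono) auto
    finally show ?thesis by simp
  qed
  ultimately show ?thesis by (rule that)
qed

text \<open>The M-test makes the finite partial sums converge uniformly, and uniform limits of
  holomorphic functions may be differentiated termwise. Only the functions need a majorant;
  summability of the derivatives is a conclusion, and this is how convergence of the series for
  \<open>wp\<close> is obtained from that for \<open>wzeta\<close>.\<close>

lemma has_field_derivative_infsum:
  fixes f :: "'a \<Rightarrow> complex \<Rightarrow> complex"
  assumes bound: "\<And>k z. k \<in> K \<Longrightarrow> z \<in> cball a r \<Longrightarrow> norm (f k z) \<le> M k"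
    and M: "M summable_on K"
    and deriv: "\<And>k z. k \<in> K \<Longrightarrow> z \<in> cball a r \<Longrightarrow> (f k has_field_derivative f' k z) (at z)"
    and z: "z \<in> ball a r"
  shows "((\<lambda>z. \<Sum>\<^sub>\<infinity>k\<in>K. f k z) has_field_derivative (\<Sum>\<^sub>\<infinity>k\<in>K. f' k z)) (at z)"
    and "(\<lambda>k. f' k z) summable_on K"
proof -
  have r: "r > 0" using z by (metis dist_not_less_zero linorder_not_less mem_ball order.strict_trans2 not_less_iff_gr_or_eq)
  have sd: "((\<lambda>z. \<Sum>k\<in>F. f k z) has_field_derivative (\<Sum>k\<in>F. f' k w)) (at w)"
    if "F \<subseteq> K" "w \<in> cball a r" for F w
    using that deriv by (intro DERIV_sum) auto
  have ev: "\<forall>\<^sub>F F in finite_subsets_at_top K.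
      continuous_on (cball a r) (\<lambda>z. \<Sum>k\<in>F. f k z) \<and>
      (\<forall>w\<in>ball a r. ((\<lambda>z. \<Sum>k\<in>F. f k z) has_field_derivative (\<Sum>k\<in>F. f' k w)) (at w))"
  proof (rule eventually_finite_subsets_at_top_weakI)
    fix F assume "finite F" and F: "F \<subseteq> K"
    have "continuous_on (cball a r) (\<lambda>z. \<Sum>k\<in>F. f k z)"
      by (rule DERIV_continuous_on) (rule has_field_derivative_at_within[OF sd[OF F]])
    then show "continuous_on (cball a r) (\<lambda>z. \<Sum>k\<in>F. f k z) \<and>
      (\<forall>w\<in>ball a r. ((\<lambda>z. \<Sum>k\<in>F. f k z) has_field_derivative (\<Sum>k\<in>F. f' k w)) (at w))"
      using sd[OF F] by auto
  qed
  obtain g' where g': "\<And>w. w \<in> ball a r \<Longrightarrow>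
      ((\<lambda>z. \<Sum>\<^sub>\<infinity>k\<in>K. f k z) has_field_derivative g' w) (at w) \<and>
      ((\<lambda>F. \<Sum>k\<in>F. f' k w) \<longlongrightarrow> g' w) (finite_subsets_at_top K)"
    using has_complex_derivative_uniform_limit[OF ev Weierstrass_m_test_general[OF bound M] _ r]
    by auto
  have "((\<lambda>k. f' k z) has_sum g' z) K" using g'[OF z] by (simp add: has_sum_def)
  then have "(\<lambda>k. f' k z) summable_on K" "(\<Sum>\<^sub>\<infinity>k\<in>K. f' k z) = g' z"
    by (auto simp: has_sum_iff)
  then show "(\<lambda>k. f' k z) summable_on K"
    "((\<lambda>z. \<Sum>\<^sub>\<infinity>k\<in>K. f k z) has_field_derivative (\<Sum>\<^sub>\<infinity>k\<in>K. f' k z)) (at z)"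
    using g'[OF z] by auto
qed

section \<open>The Weierstrass functions\<close>

lemma
  fixes f g :: "'a \<Rightarrow> 'b::{topological_ab_group_add, t2_space}"
  assumes "f summable_on A" "g summable_on A"
  shows summable_on_diff: "(\<lambda>x. f x - g x) summable_on A"
    and infsum_diff: "(\<Sum>\<^sub>\<infinity>x\<in>A. f x - g x) = infsum f A - infsum g A"
  using summable_on_add[of f A "\<lambda>x. - g x"] infsum_add[of f A "\<lambda>x. - g x"] summable_on_uminus[of g A] assms
  by (simp_all add: infsum_uminus)

text \<open>As \<open>1 / 0 = 0\<close>, the terms with \<open>\<omega> = 0\<close> are \<open>1 / z\<close> and \<open>1 / z\<^sup>2\<close>, so that \<open>\<zeta>\<close> and \<open>\<wp>\<close> are sums over
  the whole lattice. Their shift identities then hold at every \<open>z\<close>, lattice points included.\<close>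

definition zeta_term :: "complex \<Rightarrow> complex \<Rightarrow> complex" where
  "zeta_term \<omega> z = 1 / (z - \<omega>) + 1 / \<omega> + z / \<omega>^2"

definition wp_term :: "complex \<Rightarrow> complex \<Rightarrow> complex" where
  "wp_term \<omega> z = 1 / (z - \<omega>)^2 - 1 / \<omega>^2"

text \<open>The three summands combine to \<open>z^2 / (\<omega>^2 * (z - \<omega>))\<close>, and
  the denominator stays away from 0 because \<open>norm (z - \<omega>)\<close> is at least half of
  \<open>norm \<omega>\<close>.\<close>

lemma zeta_term_bound:
  assumes "norm \<omega> > 2 * R" "norm z \<le> R"
  shows "norm (zeta_term \<omega> z) \<le> 2 * R^2 * (1 / norm \<omega> ^ 3)"
proof -
  have R: "R \<ge> 0" using assms(2) norm_ge_zero[of z] by linarith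
  have w: "\<omega> \<noteq> 0" using assms R by auto
  have zw: "norm (z - \<omega>) \<ge> norm \<omega> / 2"
    using assms norm_triangle_ineq2[of \<omega> z] by (simp add: norm_minus_commute)
  have "z - \<omega> \<noteq> 0" using zw w by auto
  then have "zeta_term \<omega> z = z^2 / (\<omega>^2 * (z - \<omega>))"
    using w unfolding zeta_term_def by (simp add: divide_simps) (simp add: algebra_simps power2_eq_square)
  then have "norm (zeta_term \<omega> z) = norm z ^ 2 / (norm \<omega> ^ 2 * norm (z - \<omega>))"
    by (simp add: norm_divide norm_mult norm_power)
  also have "\<dots> \<le> R ^ 2 / (norm \<omega> ^ 2 * (norm \<omega> / 2))"
    using w zw assms(2) by (intro frac_le mult_left_mono power_mono) auto
  also have "\<dots> = 2 * R^2 * (1 / norm \<omega> ^ 3)"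
    by (simp add: power2_eq_square power3_eq_cube)
  finally show ?thesis .
qed

lemma zeta_term_deriv:
  assumes "z \<noteq> \<omega>"
  shows "(zeta_term \<omega> has_field_derivative - wp_term \<omega> z) (at z)"
  unfolding zeta_term_def[abs_def] wp_term_def using assms
  by (cases "\<omega> = 0") (auto intro!: derivative_eq_intros simp: power2_eq_square)

locale upper_lattice =
  fixes \<tau> :: complex
  assumes Im_tau: "Im \<tau> > 0"
begin

lemma zeta_sum_deriv_far:
  assumes "z \<in> ball 0 R"
  defines "K \<equiv> {\<omega> \<in> lattice \<tau>. norm \<omega> > 2 * R}"
  assumes "S \<subseteq> K"
  shows "((\<lambda>z. \<Sum>\<^sub>\<infinity>\<omega>\<in>S. zeta_term \<omega> z) has_field_derivative (\<Sum>\<^sub>\<infinity>\<omega>\<in>S. - wp_term \<omega> z)) (at z)"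
    and "(\<lambda>\<omega>. - wp_term \<omega> z) summable_on S"
    and "(\<lambda>\<omega>. zeta_term \<omega> z) summable_on S"
proof -
  have M: "(\<lambda>\<omega>. 2 * R^2 * (1 / norm \<omega> ^ 3)) summable_on S"
    by (rule summable_on_subset_banach[of _ "lattice \<tau>"], rule summable_on_cmult_right)
       (use summable_on_lattice[OF Im_tau] assms(3) in \<open>auto simp: K_def\<close>)
  have b: "norm (zeta_term \<omega> w) \<le> 2 * R^2 * (1 / norm \<omega> ^ 3)" if "\<omega> \<in> S" "w \<in> cball 0 R" for \<omega> w
    by (rule zeta_term_bound) (use that assms(3) in \<open>auto simp: K_def\<close>)
  have d: "(zeta_term \<omega> has_field_derivative - wp_term \<omega> w) (at w)" if "\<omega> \<in> S" "w \<in> cball 0 R" for \<omega> w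
  proof (rule zeta_term_deriv)
    have "norm \<omega> > 2 * R" "norm w \<le> R" using that assms(3) by (auto simp: K_def)
    moreover have "norm w \<ge> 0" by simp
    ultimately have "norm \<omega> > norm w" by linarith
    then show "w \<noteq> \<omega>" by auto
  qed
  show "((\<lambda>z. \<Sum>\<^sub>\<infinity>\<omega>\<in>S. zeta_term \<omega> z) has_field_derivative (\<Sum>\<^sub>\<infinity>\<omega>\<in>S. - wp_term \<omega> z)) (at z)"
    "(\<lambda>\<omega>. - wp_term \<omega> z) summable_on S"
    by (rule has_field_derivative_infsum[OF b M d assms(1)]; assumption)+
  show "(\<lambda>\<omega>. zeta_term \<omega> z) summable_on S"
    by (rule abs_summable_summable, rule Infinite_Sum.abs_summable_on_comparison_test'[OF M])
       (use assms(1) in \<open>intro b, auto\<close>)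
qed

lemma finite_near: "finite {\<omega> \<in> lattice \<tau>. norm \<omega> \<le> R}"
  by (rule finite_lattice_cball[OF Im_tau])

text \<open>The sum splits into finitely many terms, which may have poles near \<open>z\<close>, and
  a tail whose poles lie outside a ball around 0 containing \<open>z\<close>. The index set is an
  arbitrary part of the lattice so that both the full sum and the sum without the term at 0 are
  covered.\<close>

lemma
  assumes "S \<subseteq> lattice \<tau>"
  shows zeta_term_summable: "(\<lambda>\<omega>. zeta_term \<omega> z) summable_on S"
    and wp_term_summable: "(\<lambda>\<omega>. wp_term \<omega> z) summable_on S"
    and zeta_sum_deriv: "z \<notin> S \<Longrightarrow>
      ((\<lambda>z. \<Sum>\<^sub>\<infinity>\<omega>\<in>S. zeta_term \<omega> z) has_field_derivative - (\<Sum>\<^sub>\<infinity>\<omega>\<in>S. wp_term \<omega> z)) (at z)"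
proof -
  define R where "R = norm z + 1"
  define A where "A = {\<omega> \<in> S. norm \<omega> \<le> 2 * R}"
  define K where "K = {\<omega> \<in> S. norm \<omega> > 2 * R}"
  have fin: "finite A"
    by (rule finite_subset[OF _ finite_near[of "2 * R"]]) (use assms in \<open>auto simp: A_def\<close>)
  have S: "S = A \<union> K" "A \<inter> K = {}" by (auto simp: A_def K_def)
  have K: "K \<subseteq> {\<omega> \<in> lattice \<tau>. norm \<omega> > 2 * R}" using assms by (auto simp: K_def)
  have z: "z \<in> ball 0 R" by (simp add: R_def)
  note far = zeta_sum_deriv_far[OF _ K]
  have sz: "(\<lambda>\<omega>. zeta_term \<omega> w) summable_on S" if "w \<in> ball 0 R" for w
    unfolding S(1) using fin far(3)[OF that] by (intro summable_on_union) auto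
  have sK: "(\<lambda>\<omega>. wp_term \<omega> z) summable_on K"
    using far(2)[OF z] summable_on_uminus[of "\<lambda>\<omega>. - wp_term \<omega> z" K] by simp
  show "(\<lambda>\<omega>. zeta_term \<omega> z) summable_on S" by (rule sz[OF z])
  show "(\<lambda>\<omega>. wp_term \<omega> z) summable_on S"
    unfolding S(1) using fin sK by (intro summable_on_union) auto
  assume zS: "z \<notin> S"
  have split: "(\<Sum>\<^sub>\<infinity>\<omega>\<in>S. zeta_term \<omega> w) = (\<Sum>\<omega>\<in>A. zeta_term \<omega> w) + (\<Sum>\<^sub>\<infinity>\<omega>\<in>K. zeta_term \<omega> w)"
    if "w \<in> ball 0 R" for w
    unfolding S(1) using fin far(3)[OF that] S(2) by (subst infsum_Un_disjoint) auto
  have "((\<lambda>w. (\<Sum>\<omega>\<in>A. zeta_term \<omega> w) + (\<Sum>\<^sub>\<infinity>\<omega>\<in>K. zeta_term \<omega> w)) has_field_derivative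
      (\<Sum>\<omega>\<in>A. - wp_term \<omega> z) + (\<Sum>\<^sub>\<infinity>\<omega>\<in>K. - wp_term \<omega> z)) (at z)"
    using zS by (intro DERIV_add DERIV_sum far(1)[OF z] zeta_term_deriv) (auto simp: A_def)
  then have "((\<lambda>w. \<Sum>\<^sub>\<infinity>\<omega>\<in>S. zeta_term \<omega> w) has_field_derivative
      (\<Sum>\<omega>\<in>A. - wp_term \<omega> z) + (\<Sum>\<^sub>\<infinity>\<omega>\<in>K. - wp_term \<omega> z)) (at z)"
    by (rule has_field_derivative_transform_within_open[OF _ open_ball z]) (simp add: split)
  also have "(\<Sum>\<omega>\<in>A. - wp_term \<omega> z) + (\<Sum>\<^sub>\<infinity>\<omega>\<in>K. - wp_term \<omega> z) = - (\<Sum>\<^sub>\<infinity>\<omega>\<in>S. wp_term \<omega> z)"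
    unfolding S(1) using fin sK S(2)
    by (subst infsum_Un_disjoint) (auto simp: infsum_uminus sum_negf)
  finally show "((\<lambda>z. \<Sum>\<^sub>\<infinity>\<omega>\<in>S. zeta_term \<omega> z) has_field_derivative - (\<Sum>\<^sub>\<infinity>\<omega>\<in>S. wp_term \<omega> z)) (at z)" .
qed

lemma wp_eq_infsum: "wp \<tau> z = (\<Sum>\<^sub>\<infinity>\<omega>\<in>lattice \<tau>. wp_term \<omega> z)"
proof -
  have L: "lattice \<tau> = insert 0 (lattice \<tau> - {0})" by (simp add: insert_absorb)
  show ?thesis
    by (subst L, subst infsum_insert) (use wp_term_summable[of "lattice \<tau> - {0}" z] in \<open>auto simp: wp_def wp_term_def\<close>)
qed

lemma wzeta_eq: "wzeta \<tau> z = 1 / z + (\<Sum>\<^sub>\<infinity>\<omega>\<in>lattice \<tau> - {0}. zeta_term \<omega> z)"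
  by (simp add: wzeta_def zeta_term_def)

lemma wzeta_eq_infsum: "wzeta \<tau> z = (\<Sum>\<^sub>\<infinity>\<omega>\<in>lattice \<tau>. zeta_term \<omega> z)"
proof -
  have L: "lattice \<tau> = insert 0 (lattice \<tau> - {0})" by (simp add: insert_absorb)
  show ?thesis
    by (subst L, subst infsum_insert) (use zeta_term_summable[of "lattice \<tau> - {0}" z] in \<open>auto simp: wzeta_def zeta_term_def\<close>)
qed

lemma wzeta_deriv: "z \<notin> lattice \<tau> \<Longrightarrow> (wzeta \<tau> has_field_derivative - wp \<tau> z) (at z)"
  using zeta_sum_deriv[OF order_refl] by (simp add: wzeta_eq_infsum[abs_def] wp_eq_infsum)

lemma wzeta_minus: "wzeta \<tau> (- z) = - wzeta \<tau> z"
proof -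
  have "wzeta \<tau> (- z) = (\<Sum>\<^sub>\<infinity>\<omega>\<in>lattice \<tau>. zeta_term (- \<omega>) (- z))"
    unfolding wzeta_eq_infsum by (rule infsum_reindex_bij_betw[OF bij_betw_lattice_uminus, symmetric])
  also have "(\<lambda>\<omega>. zeta_term (- \<omega>) (- z)) = (\<lambda>\<omega>. - zeta_term \<omega> z)"
    unfolding zeta_term_def by (rule ext) (simp add: divide_simps, simp add: algebra_simps add_eq_0_iff)
  finally show ?thesis by (simp add: infsum_uminus wzeta_eq_infsum)
qed

lemma wp_minus: "wp \<tau> (- z) = wp \<tau> z"
proof -
  have "wp \<tau> (- z) = (\<Sum>\<^sub>\<infinity>\<omega>\<in>lattice \<tau>. wp_term (- \<omega>) (- z))"
    unfolding wp_eq_infsum by (rule infsum_reindex_bij_betw[OF bij_betw_lattice_uminus, symmetric])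
  also have "(\<lambda>\<omega>. wp_term (- \<omega>) (- z)) = (\<lambda>\<omega>. wp_term \<omega> z)"
    unfolding wp_term_def by (rule ext) (simp add: power2_commute)
  finally show ?thesis by (simp add: wp_eq_infsum)
qed

context
  fixes \<alpha> assumes \<alpha>: "\<alpha> \<in> lattice \<tau>"
begin

lemma
  shows shifted_wp_term_summable: "(\<lambda>\<omega>. wp_term (\<omega> + \<alpha>) z) summable_on lattice \<tau>"
    and shifted_zeta_term_summable: "(\<lambda>\<omega>. zeta_term (\<omega> + \<alpha>) z) summable_on lattice \<tau>"
  using wp_term_summable[OF order_refl, of z] zeta_term_summable[OF order_refl, of z]
  by (simp_all add: summable_on_reindex_bij_betw[OF bij_betw_lattice_shift[OF \<alpha>], where f = "\<lambda>\<omega>. wp_term \<omega> z"]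
      summable_on_reindex_bij_betw[OF bij_betw_lattice_shift[OF \<alpha>], where f = "\<lambda>\<omega>. zeta_term \<omega> z"])

lemma shift_sum_summable: "(\<lambda>\<omega>. 1 / (\<omega> + \<alpha>)^2 - 1 / \<omega>^2) summable_on lattice \<tau>"
proof -
  \<comment> \<open>At these arguments the first term is identically 0 and the second is the
    negative of the required summand.\<close>
  have "(\<lambda>\<omega>. wp_term \<omega> 0 - wp_term (\<omega> + \<alpha>) \<alpha>) summable_on lattice \<tau>"
    by (intro summable_on_diff shifted_wp_term_summable wp_term_summable) auto
  then show ?thesis by (simp add: wp_term_def)
qed

text \<open>The involution \<open>\<omega> \<mapsto> - \<omega> - \<alpha>\<close> of the lattice
  exchanges the two squares, so the sum equals its own negative.\<close>

lemma shift_sum_eq_0: "(\<Sum>\<^sub>\<infinity>\<omega>\<in>lattice \<tau>. 1 / (\<omega> + \<alpha>)^2 - 1 / \<omega>^2) = 0" (is "?c = 0")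
proof -
  have bij: "bij_betw (\<lambda>\<omega>. - \<omega> - \<alpha>) (lattice \<tau>) (lattice \<tau>)"
    by (rule bij_betwI[where g = "\<lambda>\<omega>. - \<omega> - \<alpha>"]) (auto intro!: lattice_diff \<alpha>)
  have "?c = (\<Sum>\<^sub>\<infinity>\<omega>\<in>lattice \<tau>. 1 / ((- \<omega> - \<alpha>) + \<alpha>)^2 - 1 / (- \<omega> - \<alpha>)^2)"
    by (rule infsum_reindex_bij_betw[OF bij, symmetric])
  also have "(\<lambda>\<omega>. 1 / ((- \<omega> - \<alpha>) + \<alpha>)^2 - 1 / (- \<omega> - \<alpha>)^2) = (\<lambda>\<omega>. - (1 / (\<omega> + \<alpha>)^2 - 1 / \<omega>^2))"
  proof
    fix \<omega>
    have "(- \<omega> - \<alpha>)^2 = (\<omega> + \<alpha>)^2" by (simp add: power2_eq_square algebra_simps)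
    then show "1 / ((- \<omega> - \<alpha>) + \<alpha>)^2 - 1 / (- \<omega> - \<alpha>)^2 = - (1 / (\<omega> + \<alpha>)^2 - 1 / \<omega>^2)" by simp
  qed
  finally have "?c = - ?c" by (simp only: infsum_uminus)
  then show ?thesis by simp
qed

text \<open>Reindexing by \<alpha> cancels the pole terms and leaves, independently of
  \<open>z\<close>, the negative of the sum that has just been seen to vanish.\<close>

lemma wp_periodic: "wp \<tau> (z + \<alpha>) = wp \<tau> z"
proof -
  have "wp \<tau> (z + \<alpha>) - wp \<tau> z =
      (\<Sum>\<^sub>\<infinity>\<omega>\<in>lattice \<tau>. wp_term (\<omega> + \<alpha>) (z + \<alpha>)) - (\<Sum>\<^sub>\<infinity>\<omega>\<in>lattice \<tau>. wp_term \<omega> z)"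
    unfolding wp_eq_infsum
    by (subst infsum_reindex_bij_betw[OF bij_betw_lattice_shift[OF \<alpha>], where f = "\<lambda>\<omega>. wp_term \<omega> (z + \<alpha>)"]) simp
  also have "\<dots> = (\<Sum>\<^sub>\<infinity>\<omega>\<in>lattice \<tau>. wp_term (\<omega> + \<alpha>) (z + \<alpha>) - wp_term \<omega> z)"
    by (rule infsum_diff[symmetric]) (intro shifted_wp_term_summable wp_term_summable order_refl)+
  also have "\<dots> = - (\<Sum>\<^sub>\<infinity>\<omega>\<in>lattice \<tau>. 1 / (\<omega> + \<alpha>)^2 - 1 / \<omega>^2)"
    by (simp add: wp_term_def flip: infsum_uminus)
  finally show ?thesis by (simp add: shift_sum_eq_0)
qed

text \<open>After reindexing, the termwise difference is affine in \<open>z\<close>. Its slope sums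
  to 0 by \<open>shift_sum_eq_0\<close>, so only a constant is left.\<close>

lemma wzeta_quasi_periodic: "\<exists>\<eta>. \<forall>z. wzeta \<tau> (z + \<alpha>) = wzeta \<tau> z + \<eta>"
proof -
  define d where "d = (\<lambda>z \<omega>. zeta_term (\<omega> + \<alpha>) (z + \<alpha>) - zeta_term \<omega> z)"
  have d: "d z summable_on lattice \<tau>" for z
    unfolding d_def by (intro summable_on_diff shifted_zeta_term_summable zeta_term_summable) auto
  have d0: "d z \<omega> = d 0 \<omega> + z * (1 / (\<omega> + \<alpha>)^2 - 1 / \<omega>^2)" for z \<omega>
    by (simp add: d_def zeta_term_def algebra_simps add_divide_distrib)
  have "wzeta \<tau> (z + \<alpha>) - wzeta \<tau> z = infsum (d 0) (lattice \<tau>)" for z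
  proof -
    have "wzeta \<tau> (z + \<alpha>) - wzeta \<tau> z =
        (\<Sum>\<^sub>\<infinity>\<omega>\<in>lattice \<tau>. zeta_term (\<omega> + \<alpha>) (z + \<alpha>)) - (\<Sum>\<^sub>\<infinity>\<omega>\<in>lattice \<tau>. zeta_term \<omega> z)"
      unfolding wzeta_eq_infsum
      by (subst infsum_reindex_bij_betw[OF bij_betw_lattice_shift[OF \<alpha>], where f = "\<lambda>\<omega>. zeta_term \<omega> (z + \<alpha>)"]) simp
    also have "\<dots> = infsum (d z) (lattice \<tau>)"
      unfolding d_def
      by (rule infsum_diff[symmetric]) (intro shifted_zeta_term_summable zeta_term_summable order_refl)+
    also have "d z = (\<lambda>\<omega>. d 0 \<omega> + z * (1 / (\<omega> + \<alpha>)^2 - 1 / \<omega>^2))" using d0 by blast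
    also have "infsum \<dots> (lattice \<tau>) = infsum (d 0) (lattice \<tau>) + z * (\<Sum>\<^sub>\<infinity>\<omega>\<in>lattice \<tau>. 1 / (\<omega> + \<alpha>)^2 - 1 / \<omega>^2)"
      by (subst infsum_add) (auto intro!: d summable_on_cmult_right shift_sum_summable simp: infsum_cmult_right')
    finally show ?thesis by (simp add: shift_sum_eq_0)
  qed
  then show ?thesis by (metis add.commute diff_add_cancel)
qed

end

end

section \<open>The sigma product and its logarithmic derivative\<close>

definition sigma_factor :: "complex \<Rightarrow> complex \<Rightarrow> complex" where
  "sigma_factor \<omega> z = (1 - z / \<omega>) * exp (z / \<omega> + z^2 / (2 * \<omega>^2))"

text \<open>The principal logarithm is harmless here: for \<open>norm z < norm \<omega>\<close> its
  argument has positive real part. Only such \<open>z\<close> are used.\<close>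

definition log_sigma_factor :: "complex \<Rightarrow> complex \<Rightarrow> complex" where
  "log_sigma_factor \<omega> z = Ln (1 - z / \<omega>) + z / \<omega> + z^2 / (2 * \<omega>^2)"

text \<open>The logarithmic derivative of each Weierstrass factor is the matching term of the zeta
  series; this is what turns the product into \<open>wzeta\<close>.\<close>

lemma sigma_factor_deriv:
  assumes "\<omega> \<noteq> 0" "z \<noteq> \<omega>"
  shows "(sigma_factor \<omega> has_field_derivative zeta_term \<omega> z * sigma_factor \<omega> z) (at z)"
proof -
  have "((\<lambda>z. z / \<omega> + z^2 / (2 * \<omega>^2)) has_field_derivative 1 / \<omega> + z / \<omega>^2) (at z)"
    using assms by (auto intro!: derivative_eq_intros simp: power2_eq_square)
  note e = DERIV_chain2[OF DERIV_exp this]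
  have "((\<lambda>z. 1 - z / \<omega>) has_field_derivative - 1 / \<omega>) (at z)"
    using assms by (auto intro!: derivative_eq_intros)
  from DERIV_mult[OF this e]
  have "(sigma_factor \<omega> has_field_derivative
      (- 1 / \<omega>) * exp (z / \<omega> + z^2 / (2 * \<omega>^2)) +
      (1 - z / \<omega>) * (exp (z / \<omega> + z^2 / (2 * \<omega>^2)) * (1 / \<omega> + z / \<omega>^2))) (at z)"
    unfolding sigma_factor_def[abs_def] by (simp add: mult.commute)
  also have "(- 1 / \<omega>) * exp (z / \<omega> + z^2 / (2 * \<omega>^2)) +
      (1 - z / \<omega>) * (exp (z / \<omega> + z^2 / (2 * \<omega>^2)) * (1 / \<omega> + z / \<omega>^2)) =
      (- 1 / \<omega> + (1 - z / \<omega>) * (1 / \<omega> + z / \<omega>^2)) * exp (z / \<omega> + z^2 / (2 * \<omega>^2))"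
    by (simp only: distrib_right mult_ac distrib_left)
  also have "- 1 / \<omega> + (1 - z / \<omega>) * (1 / \<omega> + z / \<omega>^2) = zeta_term \<omega> z * (1 - z / \<omega>)"
    using assms unfolding zeta_term_def
    by (simp add: divide_simps) (simp add: algebra_simps power2_eq_square)
  finally show ?thesis by (simp add: sigma_factor_def[abs_def] mult.assoc)
qed

lemma sigma_factor_nonzero: "\<omega> \<noteq> 0 \<Longrightarrow> z \<noteq> \<omega> \<Longrightarrow> sigma_factor \<omega> z \<noteq> 0"
  by (simp add: sigma_factor_def)

lemma exp_log_sigma_factor:
  assumes "\<omega> \<noteq> 0" "z \<noteq> \<omega>"
  shows "exp (log_sigma_factor \<omega> z) = sigma_factor \<omega> z"
  using assms by (simp add: log_sigma_factor_def sigma_factor_def exp_add)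

lemma log_sigma_factor_deriv:
  assumes "norm z < norm \<omega>"
  shows "(log_sigma_factor \<omega> has_field_derivative zeta_term \<omega> z) (at z)"
proof -
  have w: "\<omega> \<noteq> 0" "z \<noteq> \<omega>" using assms by auto
  have "norm (z / \<omega>) < 1" using assms w by (simp add: norm_divide)
  then have "Re (1 - z / \<omega>) > 0" using complex_Re_le_cmod[of "z / \<omega>"] by simp
  then have "1 - z / \<omega> \<notin> \<real>\<^sub>\<le>\<^sub>0" by (auto simp: complex_nonpos_Reals_iff)
  then have "(log_sigma_factor \<omega> has_field_derivative
      - 1 / \<omega> / (1 - z / \<omega>) + 1 / \<omega> + z / \<omega>^2) (at z)"
    unfolding log_sigma_factor_def[abs_def] using w
    by (auto intro!: derivative_eq_intros simp: field_simps)
  also have "- 1 / \<omega> / (1 - z / \<omega>) = 1 / (z - \<omega>)"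
    using w by (simp add: field_simps)
  finally show ?thesis by (simp add: zeta_term_def)
qed

text \<open>The logarithm vanishes at 0 and its derivative is \<open>zeta_term\<close>, so the mean
  value inequality turns the bound for the latter into one with an extra factor
  \<open>R\<close>.\<close>

lemma log_sigma_factor_bound:
  assumes "norm \<omega> > 2 * R" "norm z \<le> R"
  shows "norm (log_sigma_factor \<omega> z) \<le> 2 * R^3 * (1 / norm \<omega> ^ 3)"
proof -
  have R: "R \<ge> 0" using assms(2) norm_ge_zero[of z] by linarith
  have "norm (log_sigma_factor \<omega> z - log_sigma_factor \<omega> 0) \<le> 2 * R^2 * (1 / norm \<omega> ^ 3) * norm (z - 0)"
  proof (rule field_differentiable_bound[of "cball 0 R"])
    fix w :: complex assume w: "w \<in> cball 0 R"
    then have "norm w \<le> R" by simp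
    then have "norm w < norm \<omega>" using assms(1) R by linarith
    then show "(log_sigma_factor \<omega> has_field_derivative zeta_term \<omega> w) (at w within cball 0 R)"
      by (rule has_field_derivative_at_within[OF log_sigma_factor_deriv])
    show "norm (zeta_term \<omega> w) \<le> 2 * R^2 * (1 / norm \<omega> ^ 3)"
      using w by (intro zeta_term_bound[OF assms(1)]) simp
  next
    show "z \<in> cball 0 R" "0 \<in> cball 0 R" using assms(2) R by simp_all
  qed (rule convex_cball)
  also have "\<dots> \<le> 2 * R^2 * (1 / norm \<omega> ^ 3) * R"
    using assms by (intro mult_left_mono) auto
  finally show ?thesis by (simp add: log_sigma_factor_def power2_eq_square power3_eq_cube)
qed

context upper_lattice
begin

text \<open>Near \<open>z\<close> the product is \<open>w\<close> times finitely many nonzero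
  factors times the exponential of a convergent sum of logarithms. The exponential makes
  nonvanishing immediate, and the three logarithmic derivatives add up to the zeta series.\<close>

lemma
  assumes z: "z \<notin> lattice \<tau>"
  shows wsigma_deriv: "(wsigma \<tau> has_field_derivative wzeta \<tau> z * wsigma \<tau> z) (at z)"
    and wsigma_nonzero: "wsigma \<tau> z \<noteq> 0"
proof -
  define R where "R = norm z + 1"
  define A where "A = {\<omega> \<in> lattice \<tau> - {0}. norm \<omega> \<le> 2 * R}"
  define K where "K = {\<omega> \<in> lattice \<tau>. norm \<omega> > 2 * R}"
  have fin: "finite A"
    by (rule finite_subset[OF _ finite_near[of "2 * R"]]) (auto simp: A_def)
  have R: "R > 0" and zR: "z \<in> ball 0 R" by (auto simp: R_def add_nonneg_pos)
  have S: "lattice \<tau> - {0} = A \<union> K" "A \<inter> K = {}" using R by (auto simp: A_def K_def)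
  define s where "s = (\<lambda>w. \<Sum>\<^sub>\<infinity>\<omega>\<in>K. log_sigma_factor \<omega> w)"
  have M: "(\<lambda>\<omega>. 2 * R^3 * (1 / norm \<omega> ^ 3)) summable_on K"
    by (rule summable_on_subset_banach[of _ "lattice \<tau>"], rule summable_on_cmult_right)
       (use summable_on_lattice[OF Im_tau] in \<open>auto simp: K_def\<close>)
  have b: "norm (log_sigma_factor \<omega> w) \<le> 2 * R^3 * (1 / norm \<omega> ^ 3)" if "\<omega> \<in> K" "w \<in> cball 0 R" for \<omega> w
    by (rule log_sigma_factor_bound) (use that in \<open>auto simp: K_def\<close>)
  have d: "(log_sigma_factor \<omega> has_field_derivative zeta_term \<omega> w) (at w)" if "\<omega> \<in> K" "w \<in> cball 0 R" for \<omega> w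
    by (rule log_sigma_factor_deriv) (use that R in \<open>auto simp: K_def\<close>)
  have s_deriv: "(s has_field_derivative (\<Sum>\<^sub>\<infinity>\<omega>\<in>K. zeta_term \<omega> z)) (at z)"
    unfolding s_def by (rule has_field_derivative_infsum(1)[OF b M d zR])
  have sigma: "wsigma \<tau> w = w * ((\<Prod>\<omega>\<in>A. sigma_factor \<omega> w) * exp (s w))" if w: "w \<in> ball 0 R" for w
  proof -
    \<comment> \<open>Setting the near terms to 0 lets one sum over the whole index set represent
      the tail, so that its net of finite sums can be compared with the net of finite products in
      \<open>wsigma\<close>.\<close>
    define l where "l = (\<lambda>\<omega>. if \<omega> \<in> A then 0 else log_sigma_factor \<omega> w)"
    have "(\<lambda>\<omega>. log_sigma_factor \<omega> w) summable_on K"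
      by (rule abs_summable_summable, rule Infinite_Sum.abs_summable_on_comparison_test'[OF M])
         (use w in \<open>intro b, auto\<close>)
    then have "((\<lambda>\<omega>. log_sigma_factor \<omega> w) has_sum s w) K" by (simp add: s_def)
    also have "?this \<longleftrightarrow> (l has_sum s w) (lattice \<tau> - {0})"
      unfolding S(1) using S(2) by (intro has_sum_cong_neutral) (auto simp: l_def)
    finally have "(sum l \<longlongrightarrow> s w) (finite_subsets_at_top (lattice \<tau> - {0}))" by (simp add: has_sum_def)
    then have "((\<lambda>F. (\<Prod>\<omega>\<in>A. sigma_factor \<omega> w) * exp (sum l F)) \<longlongrightarrow>
        (\<Prod>\<omega>\<in>A. sigma_factor \<omega> w) * exp (s w)) (finite_subsets_at_top (lattice \<tau> - {0}))"
      by (intro tendsto_intros)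
    moreover have "\<forall>\<^sub>F F in finite_subsets_at_top (lattice \<tau> - {0}).
        (\<Prod>\<omega>\<in>A. sigma_factor \<omega> w) * exp (sum l F) = (\<Prod>\<omega>\<in>F. sigma_factor \<omega> w)"
      unfolding eventually_finite_subsets_at_top
    proof (intro exI[of _ A] conjI allI impI)
      fix F assume F: "finite F \<and> A \<subseteq> F \<and> F \<subseteq> lattice \<tau> - {0}"
      have "sum l F = sum l A + sum l (F - A)"
        using F fin by (metis add.commute sum.subset_diff)
      also have "\<dots> = (\<Sum>\<omega>\<in>F - A. log_sigma_factor \<omega> w)" by (simp add: l_def)
      also have "exp \<dots> = (\<Prod>\<omega>\<in>F - A. exp (log_sigma_factor \<omega> w))" using F by (simp add: exp_sum)
      also have "\<dots> = (\<Prod>\<omega>\<in>F - A. sigma_factor \<omega> w)"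
      proof (intro prod.cong refl exp_log_sigma_factor)
        fix \<omega> assume "\<omega> \<in> F - A"
        with F S(1) have "\<omega> \<in> K" by blast
        then have "2 * R < norm \<omega>" by (simp add: K_def)
        moreover have "norm w < R" using w by simp
        ultimately have "norm w < norm \<omega>" "0 < norm \<omega>" using R by linarith+
        then show "\<omega> \<noteq> 0" "w \<noteq> \<omega>" by auto
      qed
      finally show "(\<Prod>\<omega>\<in>A. sigma_factor \<omega> w) * exp (sum l F) = (\<Prod>\<omega>\<in>F. sigma_factor \<omega> w)"
        using F fin by (metis mult.commute prod.subset_diff)
    qed (use fin S(1) in auto)
    ultimately have "((\<lambda>F. \<Prod>\<omega>\<in>F. sigma_factor \<omega> w) \<longlongrightarrow>
        (\<Prod>\<omega>\<in>A. sigma_factor \<omega> w) * exp (s w)) (finite_subsets_at_top (lattice \<tau> - {0}))"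
      by (rule Lim_transform_eventually)
    then have "Lim (finite_subsets_at_top (lattice \<tau> - {0})) (\<lambda>F. \<Prod>\<omega>\<in>F. sigma_factor \<omega> w) =
        (\<Prod>\<omega>\<in>A. sigma_factor \<omega> w) * exp (s w)"
      by (intro tendsto_Lim) auto
    then show ?thesis by (simp add: wsigma_def sigma_factor_def)
  qed
  have nz: "z \<noteq> 0" "\<omega> \<noteq> 0" "z \<noteq> \<omega>" if "\<omega> \<in> A" for \<omega>
    using z that by (auto simp: A_def)
  have z0: "z \<noteq> 0" using z by auto
  have pnz: "(\<Prod>\<omega>\<in>A. sigma_factor \<omega> z) \<noteq> 0"
    using fin nz by (simp add: sigma_factor_nonzero)
  show "wsigma \<tau> z \<noteq> 0" using sigma[OF zR] pnz z0 by simp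
  define P where "P = (\<lambda>w. \<Prod>\<omega>\<in>A. sigma_factor \<omega> w)"
  have P: "(P has_field_derivative P z * (\<Sum>\<omega>\<in>A. zeta_term \<omega> z)) (at z)"
  proof -
    have "(P has_field_derivative P z * (\<Sum>\<omega>\<in>A. zeta_term \<omega> z * sigma_factor \<omega> z / sigma_factor \<omega> z)) (at z)"
      unfolding P_def using nz
      by (intro has_field_derivative_prod' sigma_factor_deriv sigma_factor_nonzero)
    also have "(\<Sum>\<omega>\<in>A. zeta_term \<omega> z * sigma_factor \<omega> z / sigma_factor \<omega> z) = (\<Sum>\<omega>\<in>A. zeta_term \<omega> z)"
      using nz by (intro sum.cong) (auto simp: sigma_factor_nonzero)
    finally show ?thesis .
  qed
  have "((\<lambda>w. w * (P w * exp (s w))) has_field_derivative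
      (1 / z + (\<Sum>\<omega>\<in>A. zeta_term \<omega> z) + (\<Sum>\<^sub>\<infinity>\<omega>\<in>K. zeta_term \<omega> z)) * (z * (P z * exp (s z)))) (at z)"
    using z0 by (auto intro!: derivative_eq_intros P s_deriv simp: field_simps)
  then have "(wsigma \<tau> has_field_derivative
      (1 / z + (\<Sum>\<omega>\<in>A. zeta_term \<omega> z) + (\<Sum>\<^sub>\<infinity>\<omega>\<in>K. zeta_term \<omega> z)) * (z * (P z * exp (s z)))) (at z)"
    by (rule has_field_derivative_transform_within_open[OF _ open_ball zR]) (simp add: sigma P_def)
  also have "z * (P z * exp (s z)) = wsigma \<tau> z" using sigma[OF zR] by (simp add: P_def)
  also have "1 / z + (\<Sum>\<omega>\<in>A. zeta_term \<omega> z) + (\<Sum>\<^sub>\<infinity>\<omega>\<in>K. zeta_term \<omega> z) = wzeta \<tau> z"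
    unfolding wzeta_eq S(1) using fin S(2) zeta_term_summable[of K z]
    by (subst infsum_Un_disjoint) (auto simp: K_def)
  finally show "(wsigma \<tau> has_field_derivative wzeta \<tau> z * wsigma \<tau> z) (at z)" .
qed

end

section \<open>Elliptic functions\<close>

text \<open>A removable singularity: agreement is asked only on a punctured neighbourhood, because
  the values of \<open>wp\<close> and \<open>wzeta\<close> at lattice points carry no
  meaning.\<close>

definition analytically_extendable :: "(complex \<Rightarrow> complex) \<Rightarrow> complex \<Rightarrow> bool" where
  "analytically_extendable f z \<longleftrightarrow> (\<exists>g. g analytic_on {z} \<and> (\<forall>\<^sub>F w in at z. f w = g w))"

lemma analytically_extendableI:
  "g analytic_on {z} \<Longrightarrow> (\<forall>\<^sub>F w in at z. f w = g w) \<Longrightarrow> analytically_extendable f z"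
  unfolding analytically_extendable_def by blast

lemma analytically_extendable_analytic: "f analytic_on {z} \<Longrightarrow> analytically_extendable f z"
  by (rule analytically_extendableI) auto

lemma analytically_extendable_add:
  assumes "analytically_extendable f z" "analytically_extendable g z"
  shows "analytically_extendable (\<lambda>w. f w + g w) z"
proof -
  obtain f' g' where *: "f' analytic_on {z}" "\<forall>\<^sub>F w in at z. f w = f' w"
      "g' analytic_on {z}" "\<forall>\<^sub>F w in at z. g w = g' w"
    using assms by (auto simp: analytically_extendable_def)
  show ?thesis
    by (rule analytically_extendableI[OF analytic_on_add[OF *(1,3)]])
       (use *(2,4) in eventually_elim, simp)
qed

lemma analytically_extendable_diff:
  assumes "analytically_extendable f z" "analytically_extendable g z"
  shows "analytically_extendable (\<lambda>w. f w - g w) z"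
proof -
  obtain f' g' where *: "f' analytic_on {z}" "\<forall>\<^sub>F w in at z. f w = f' w"
      "g' analytic_on {z}" "\<forall>\<^sub>F w in at z. g w = g' w"
    using assms by (auto simp: analytically_extendable_def)
  show ?thesis
    by (rule analytically_extendableI[OF analytic_on_diff[OF *(1,3)]])
       (use *(2,4) in eventually_elim, simp)
qed

text \<open>The difference quotient has a removable singularity at \<open>a\<close>. Being defined
  by division everywhere else, it satisfies the factorization at every \<open>w\<close>, without any
  restriction to a neighbourhood.\<close>

lemma analytic_factor_zero:
  assumes "u analytic_on {a}" "u a = 0"
  obtains v where "v analytic_on {a}" "v a = deriv u a" "\<And>w. u w = (w - a) * v w"
proof -
  obtain S where S: "open S" "a \<in> S" "u holomorphic_on S"
    using assms(1) by (auto simp: analytic_at)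
  define v where "v = (\<lambda>z. if z = a then deriv u a else (u z - u a) / (z - a))"
  have "v holomorphic_on S"
    unfolding v_def using S by (intro pole_lemma) (auto simp: interior_open)
  then have "v analytic_on {a}" using S by (auto simp: analytic_at)
  moreover have "u w = (w - a) * v w" for w by (simp add: v_def assms(2))
  ultimately show ?thesis by (intro that[of v]) (auto simp: v_def)
qed

lemma analytic_factor_double_zero:
  assumes "u analytic_on {a}" "u a = 0" "deriv u a = 0"
  obtains v where "v analytic_on {a}" "\<And>w. u w = (w - a)^2 * v w"
proof -
  obtain v where v: "v analytic_on {a}" "v a = deriv u a" "\<And>w. u w = (w - a) * v w"
    using analytic_factor_zero[OF assms(1,2)] by blast
  obtain x where x: "x analytic_on {a}" "\<And>w. v w = (w - a) * x w"
    using analytic_factor_zero[OF v(1)] v(2) assms(3) by metis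
  show ?thesis by (rule that[OF x(1)]) (simp add: v(3) x(2) power2_eq_square)
qed

lemma deriv_even:
  fixes f :: "complex \<Rightarrow> complex"
  assumes "\<And>z. f (- z) = f z" "f field_differentiable at z"
  shows "deriv f (- z) = - deriv f z"
proof -
  have "((\<lambda>z. f (- z)) has_field_derivative deriv f z * - 1) (at (- z))"
    by (rule DERIV_chain2[where g = uminus])
       (use assms(2) in \<open>auto intro!: derivative_eq_intros field_differentiable_derivI\<close>)
  then show ?thesis by (simp add: assms(1) DERIV_imp_deriv)
qed

text \<open>The translated functions are equal, so no differentiability is assumed and the identity
  holds at lattice points as well.\<close>

lemma deriv_periodic:
  fixes f :: "complex \<Rightarrow> complex"
  assumes "\<And>z. f (z + a) = f z"
  shows "deriv f (z + a) = deriv f z"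
proof -
  have "deriv f (z + a) = deriv (f \<circ> (+) (z + a)) 0" by (rule deriv_shift_0)
  also have "f \<circ> (+) (z + a) = f \<circ> (+) z"
  proof
    fix x
    show "(f \<circ> (+) (z + a)) x = (f \<circ> (+) z) x"
      using assms[of "z + x"] by (simp add: add_ac)
  qed
  also have "deriv \<dots> 0 = deriv f z" by (rule deriv_shift_0[symmetric])
  finally show ?thesis .
qed

section \<open>Discreteness, expansions at the origin and Liouville's theorem\<close>

context upper_lattice
begin

lemma lattice_discrete:
  obtains e where "e > 0" "\<And>\<omega>. \<omega> \<in> lattice \<tau> \<Longrightarrow> \<omega> \<in> ball z e \<Longrightarrow> \<omega> = z"
proof -
  obtain d where d: "d > 0" "\<forall>\<omega>\<in>{\<omega> \<in> lattice \<tau>. norm \<omega> \<le> norm z + 1}. \<omega> \<noteq> z \<longrightarrow> d \<le> dist z \<omega>"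
    using finite_set_avoid[OF finite_near] by blast
  show ?thesis
  proof (rule that[of "min d 1"])
    fix \<omega> assume w: "\<omega> \<in> lattice \<tau>" "\<omega> \<in> ball z (min d 1)"
    then have "dist z \<omega> < 1" "dist z \<omega> < d" by auto
    moreover have "norm \<omega> \<le> norm z + dist z \<omega>"
      using norm_triangle_sub[of \<omega> z] by (simp add: dist_norm norm_minus_commute)
    ultimately show "\<omega> = z" using d(2) w(1) by force
  qed (use d(1) in auto)
qed

lemma closed_subset_lattice:
  assumes "S \<subseteq> lattice \<tau>"
  shows "closed S"
proof -
  have "\<exists>e>0. ball z e \<subseteq> - S" if "z \<in> - S" for z
  proof -
    obtain e where "e > 0" "\<And>\<omega>. \<omega> \<in> lattice \<tau> \<Longrightarrow> \<omega> \<in> ball z e \<Longrightarrow> \<omega> = z"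
      using lattice_discrete[of z] by blast
    then show ?thesis using assms that by (intro exI[of _ e]) blast
  qed
  then show ?thesis by (simp add: closed_def open_contains_ball)
qed

lemma open_Compl_lattice: "open (- lattice \<tau>)"
  using closed_subset_lattice[OF order_refl] by (simp add: open_Compl)

lemma eventually_notin_lattice: "\<forall>\<^sub>F w in at z. w \<notin> lattice \<tau>"
proof -
  obtain e where "e > 0" "\<And>\<omega>. \<omega> \<in> lattice \<tau> \<Longrightarrow> \<omega> \<in> ball z e \<Longrightarrow> \<omega> = z"
    using lattice_discrete[of z] by blast
  then show ?thesis unfolding eventually_at by (auto simp: dist_commute)
qed

lemma wzeta_holomorphic: "wzeta \<tau> holomorphic_on - lattice \<tau>"
  using wzeta_deriv open_Compl_lattice by (auto simp: holomorphic_on_open)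

lemma wzeta_analytic: "z \<notin> lattice \<tau> \<Longrightarrow> wzeta \<tau> analytic_on {z}"
  using wzeta_holomorphic open_Compl_lattice by (auto simp: analytic_at)

lemma wp_holomorphic: "wp \<tau> holomorphic_on - lattice \<tau>"
proof -
  have "(\<lambda>z. - deriv (wzeta \<tau>) z) holomorphic_on - lattice \<tau>"
    by (intro holomorphic_intros wzeta_holomorphic open_Compl_lattice)
  also have "?this \<longleftrightarrow> ?thesis"
    by (rule holomorphic_cong) (auto dest!: wzeta_deriv DERIV_imp_deriv)
  finally show ?thesis .
qed

lemma wp_analytic: "z \<notin> lattice \<tau> \<Longrightarrow> wp \<tau> analytic_on {z}"
  using wp_holomorphic open_Compl_lattice by (auto simp: analytic_at)

lemma wp_has_deriv: "z \<notin> lattice \<tau> \<Longrightarrow> (wp \<tau> has_field_derivative deriv (wp \<tau>) z) (at z)"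
  using wp_analytic[of z] analytic_on_imp_differentiable_at field_differentiable_derivI by blast

lemma deriv_wp_minus: "z \<notin> lattice \<tau> \<Longrightarrow> deriv (wp \<tau>) (- z) = - deriv (wp \<tau>) z"
  using wp_has_deriv by (intro deriv_even wp_minus) (auto simp: field_differentiable_def)

text \<open>Omitting the lattice point 0 splits off the principal part at the origin exactly, so
  pole cancellations become identities between functions instead of statements about Laurent
  series.\<close>

definition wp_reg :: "complex \<Rightarrow> complex" where
  "wp_reg z = (\<Sum>\<^sub>\<infinity>\<omega>\<in>lattice \<tau> - {0}. wp_term \<omega> z)"

definition zeta_reg :: "complex \<Rightarrow> complex" where
  "zeta_reg z = (\<Sum>\<^sub>\<infinity>\<omega>\<in>lattice \<tau> - {0}. zeta_term \<omega> z)"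

lemma wp_eq_reg: "wp \<tau> z = 1 / z^2 + wp_reg z"
  by (simp add: wp_reg_def wp_def wp_term_def)

lemma wzeta_eq_reg: "wzeta \<tau> z = 1 / z + zeta_reg z"
  by (simp add: zeta_reg_def wzeta_eq)

lemma zeta_reg_deriv: "z \<notin> lattice \<tau> - {0} \<Longrightarrow> (zeta_reg has_field_derivative - wp_reg z) (at z)"
  unfolding zeta_reg_def[abs_def] wp_reg_def by (rule zeta_sum_deriv) auto

lemma open_reg: "open (- (lattice \<tau> - {0}))"
  using closed_subset_lattice[of "lattice \<tau> - {0}"] unfolding closed_def by blast

lemma zeta_reg_holomorphic: "zeta_reg holomorphic_on - (lattice \<tau> - {0})"
  using zeta_reg_deriv by (subst holomorphic_on_open[OF open_reg]) blast

lemma zeta_reg_analytic: "zeta_reg analytic_on {0}"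
  using zeta_reg_holomorphic open_reg by (auto simp: analytic_at)

lemma wp_reg_holomorphic: "wp_reg holomorphic_on - (lattice \<tau> - {0})"
proof -
  have "deriv zeta_reg z = - wp_reg z" if "z \<in> - (lattice \<tau> - {0})" for z
    by (rule DERIV_imp_deriv[OF zeta_reg_deriv]) (use that in blast)
  note eq = this
  have "(\<lambda>z. - deriv zeta_reg z) holomorphic_on - (lattice \<tau> - {0})"
    by (intro holomorphic_intros zeta_reg_holomorphic open_reg)
  also have "?this \<longleftrightarrow> ?thesis"
    by (rule holomorphic_cong) (simp_all only: eq minus_minus)
  finally show ?thesis .
qed

lemma wp_reg_analytic: "wp_reg analytic_on {0}"
  using wp_reg_holomorphic open_reg by (auto simp: analytic_at)

text \<open>The normalizing terms of the series remove the constant terms. Together with the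
  vanishing derivatives below, both regular parts are \<open>O(z^2)\<close>, which is the order that
  the pole cancellations require.\<close>

lemma wp_reg_0: "wp_reg 0 = 0" and zeta_reg_0: "zeta_reg 0 = 0"
  by (simp_all add: wp_reg_def wp_term_def zeta_reg_def zeta_term_def)

lemma wp_reg_minus: "wp_reg (- z) = wp_reg z"
  using wp_minus[of z] by (simp add: wp_eq_reg)

lemma deriv_wp_reg_0: "deriv wp_reg 0 = 0"
  using deriv_even[of wp_reg 0] wp_reg_minus analytic_on_imp_differentiable_at[OF wp_reg_analytic]
  by simp

lemma deriv_zeta_reg_0: "deriv zeta_reg 0 = 0"
  using zeta_reg_deriv[of 0] by (auto simp: wp_reg_0 intro: DERIV_imp_deriv)

lemma deriv_wp_eq_reg:
  assumes "z \<notin> lattice \<tau>"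
  shows "deriv (wp \<tau>) z = - 2 / z^3 + deriv wp_reg z"
proof (rule DERIV_imp_deriv)
  have z0: "z \<noteq> 0" using assms by auto
  have "(wp_reg has_field_derivative deriv wp_reg z) (at z)"
    by (rule holomorphic_derivI[OF wp_reg_holomorphic open_reg]) (use assms in auto)
  then have "((\<lambda>z. 1 / z^2 + wp_reg z) has_field_derivative - 2 / z^3 + deriv wp_reg z) (at z)"
    using z0 by (auto intro!: derivative_eq_intros simp: field_simps power2_eq_square power3_eq_cube)
  then show "(wp \<tau> has_field_derivative - 2 / z^3 + deriv wp_reg z) (at z)"
    by (simp add: wp_eq_reg[abs_def])
qed

lemma deriv_deriv_wp_eq_reg:
  assumes "z \<notin> lattice \<tau>"
  shows "deriv (deriv (wp \<tau>)) z = 6 / z^4 + deriv (deriv wp_reg) z"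
proof (rule DERIV_imp_deriv)
  have z0: "z \<noteq> 0" using assms by auto
  have "(deriv wp_reg has_field_derivative deriv (deriv wp_reg) z) (at z)"
    by (rule holomorphic_derivI[OF holomorphic_deriv[OF wp_reg_holomorphic open_reg] open_reg])
       (use assms in auto)
  then have "((\<lambda>z. - 2 / z^3 + deriv wp_reg z) has_field_derivative 6 / z^4 + deriv (deriv wp_reg) z) (at z)"
    using z0 by (auto intro!: derivative_eq_intros simp: field_simps eval_nat_numeral)
  then show "(deriv (wp \<tau>) has_field_derivative 6 / z^4 + deriv (deriv wp_reg) z) (at z)"
    by (rule has_field_derivative_transform_within_open[OF _ open_Compl_lattice])
       (use assms in \<open>auto simp: deriv_wp_eq_reg\<close>)
qed

text \<open>Replacing each value by the limit gives an entire function. It is periodic, so its range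
  is the image of a compact ball and Liouville's theorem applies. The conclusion is restricted to
  punctured neighbourhoods because \<phi> itself may take wrong values at its removable
  singularities.\<close>

lemma elliptic_constant:
  assumes periodic: "\<And>\<alpha> z. \<alpha> \<in> lattice \<tau> \<Longrightarrow> \<phi> (z + \<alpha>) = \<phi> z"
    and ext: "\<And>z. analytically_extendable \<phi> z"
  obtains c where "\<And>z. \<forall>\<^sub>F w in at z. \<phi> w = c"
proof -
  define \<psi> where "\<psi> = (\<lambda>z. Lim (at z) \<phi>)"
  have \<psi>: "\<exists>g. g analytic_on {z} \<and> (\<forall>\<^sub>F w in at z. \<phi> w = g w) \<and> (\<forall>\<^sub>F w in nhds z. \<psi> w = g w)" for z
  proof -
    obtain g where g: "g analytic_on {z}" "\<forall>\<^sub>F w in at z. \<phi> w = g w"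
      using ext[of z] by (auto simp: analytically_extendable_def)
    have eq: "\<psi> w = g w" if "g analytic_on {w}" "\<forall>\<^sub>F x in at w. \<phi> x = g x" for w
    proof -
      have "isCont g w" using that(1) by (rule analytic_at_imp_isCont)
      then have "(\<phi> \<longlongrightarrow> g w) (at w)"
        using that(2) by (auto simp: isCont_def cong: tendsto_cong)
      then show ?thesis unfolding \<psi>_def by (intro tendsto_Lim) auto
    qed
    obtain S where S: "open S" "z \<in> S" "g holomorphic_on S"
      using g(1) by (auto simp: analytic_at)
    obtain T where T: "open T" "z \<in> T" "\<And>w. w \<in> T \<Longrightarrow> w \<noteq> z \<Longrightarrow> \<phi> w = g w"
      using g(2) by (auto simp: eventually_at_topological)
    \<comment> \<open>At points other than \<open>z\<close> the comparison uses
      \<open>T - {z}\<close>, where \<phi> and \<open>g\<close> agree; at \<open>z\<close> itself it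
      is the given punctured agreement.\<close>
    have "\<psi> w = g w" if w: "w \<in> S \<inter> T" for w
    proof (rule eq)
      show "g analytic_on {w}" using S w by (auto simp: analytic_at)
      show "\<forall>\<^sub>F x in at w. \<phi> x = g x"
      proof (cases "w = z")
        case False
        have "open (T - {z})" using T(1) by (rule open_delete)
        then show ?thesis using w False T(3) unfolding eventually_at_topological
          by (intro exI[of _ "T - {z}"]) auto
      qed (use g in auto)
    qed
    then have "\<forall>\<^sub>F w in nhds z. \<psi> w = g w"
      using S T unfolding eventually_nhds by (intro exI[of _ "S \<inter> T"]) auto
    with g show ?thesis by blast
  qed
  have "\<psi> analytic_on {z}" for z
    using \<psi>[of z] analytic_at_cong by blast
  then have hol: "\<psi> holomorphic_on UNIV"
    by (meson analytic_imp_holomorphic analytic_on_analytic_at)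
  have per: "\<psi> (z + \<alpha>) = \<psi> z" if "\<alpha> \<in> lattice \<tau>" for z \<alpha>
  proof -
    \<comment> \<open>Translation identifies the punctured neighbourhoods, so both points admit the
      same limits and \<open>Lim\<close> selects the same value.\<close>
    have "at (z + \<alpha>) = filtermap (\<lambda>w. w + \<alpha>) (at z)" using filtermap_at_shift[of "- \<alpha>" z] by simp
    then have "(\<phi> \<longlongrightarrow> c) (at (z + \<alpha>)) \<longleftrightarrow> (\<phi> \<longlongrightarrow> c) (at z)" for c
      by (simp add: tendsto_def eventually_filtermap periodic[OF that])
    then show ?thesis unfolding \<psi>_def Topological_Spaces.Lim_def by simp
  qed
  have "bounded (\<psi> ` cball 0 (1 + norm \<tau>))"
    by (intro compact_imp_bounded compact_continuous_image compact_cball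
        holomorphic_on_imp_continuous_on holomorphic_on_subset[OF hol]) auto
  moreover have "range \<psi> \<subseteq> \<psi> ` cball 0 (1 + norm \<tau>)"
  proof clarify
    fix z
    obtain \<alpha> where "\<alpha> \<in> lattice \<tau>" "norm (z + \<alpha>) \<le> 1 + norm \<tau>"
      by (rule lattice_representative[OF Im_tau])
    then show "\<psi> z \<in> \<psi> ` cball 0 (1 + norm \<tau>)"
      by (intro image_eqI[of _ _ "z + \<alpha>"]) (auto simp: per)
  qed
  ultimately obtain c where c: "\<And>z. \<psi> z = c"
    using Liouville_theorem[OF hol] bounded_subset by (auto simp: constant_on_def)
  show ?thesis
  proof (rule that[of c])
    fix z
    obtain g where g: "\<forall>\<^sub>F w in at z. \<phi> w = g w" "\<forall>\<^sub>F w in nhds z. \<psi> w = g w"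
      using \<psi>[of z] by blast
    from g(2) have "\<forall>\<^sub>F w in at z. \<psi> w = g w" by (simp add: eventually_nhds_conv_at)
    with g(1) show "\<forall>\<^sub>F w in at z. \<phi> w = c" by eventually_elim (use c in auto)
  qed
qed

text \<open>Reduces the examination of the poles at all lattice points to the one at 0.\<close>

lemma analytically_extendable_shift:
  assumes "analytically_extendable \<phi> z" "\<And>z. \<phi> (z + \<alpha>) = \<phi> z"
  shows "analytically_extendable \<phi> (z + \<alpha>)"
proof -
  obtain g where g: "g analytic_on {z}" "\<forall>\<^sub>F w in at z. \<phi> w = g w"
    using assms by (auto simp: analytically_extendable_def)
  have "at (z + \<alpha>) = filtermap (\<lambda>w. w + \<alpha>) (at z)" using filtermap_at_shift[of "- \<alpha>" z] by simp
  then have "\<forall>\<^sub>F w in at (z + \<alpha>). \<phi> w = g (w - \<alpha>)"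
    using g(2) by (simp add: eventually_filtermap assms(2))
  moreover have "(\<lambda>w. g (w - \<alpha>)) analytic_on {z + \<alpha>}"
    by (rule analytic_on_compose_gen[where g = g and T = "{z}", unfolded o_def])
       (use g(1) in \<open>auto intro!: analytic_intros\<close>)
  ultimately show ?thesis by (intro analytically_extendableI)
qed

end

lemma eventually_const_imp_eq:
  assumes "\<forall>\<^sub>F w in at z. \<phi> w = c" "\<phi> analytic_on {z :: complex}"
  shows "\<phi> z = c"
proof -
  have "(\<phi> \<longlongrightarrow> \<phi> z) (at z)" using analytic_at_imp_isCont[OF assms(2)] by (simp add: isCont_def)
  moreover have "(\<phi> \<longlongrightarrow> c) (at z)" using assms(1) by (rule tendsto_eventually)
  ultimately show ?thesis by (rule tendsto_unique[rotated]) simp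
qed

lemma analytic_on_translate:
  assumes "g analytic_on {z + a}"
  shows "(\<lambda>w. g (w + a)) analytic_on {z}"
  by (rule analytic_on_compose_gen[where g = g and T = "{z + a}", unfolded o_def])
     (use assms in \<open>auto intro!: analytic_intros\<close>)

text \<open>\<open>m\<close> plays the role of the residue of \<open>f'/f\<close> at a zero and must
  equal the order of that zero. The hypothesis is written without division so that zeros of
  \<open>f\<close> near \<open>z\<close> cause no trouble.\<close>

lemma order_from_log_derivative:
  assumes "f holomorphic_on S" "open S" "connected S" "z \<in> S" "f z = 0" "\<not> f constant_on S"
    and G: "\<forall>\<^sub>F w in at z. (w - z) * deriv f w = (m + (w - z) * a w) * f w" and a: "isCont a z"
  obtains n where "n > 0" "m = of_nat n" "n = 1 \<Longrightarrow> deriv f z \<noteq> 0"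
proof -
  obtain g r n where *: "0 < n" "0 < r" "ball z r \<subseteq> S" "g holomorphic_on ball z r"
      "\<And>w. w \<in> ball z r \<Longrightarrow> f w = (w - z)^n * g w" "\<And>w. w \<in> ball z r \<Longrightarrow> g w \<noteq> 0"
    using holomorphic_factor_zero_nonconstant[OF assms(1-6)] by metis
  have z: "z \<in> ball z r" using *(2) by simp
  have f': "deriv f w = of_nat n * (w - z)^(n - 1) * g w + (w - z)^n * deriv g w" if w: "w \<in> ball z r" for w
  proof (rule DERIV_imp_deriv)
    have "(g has_field_derivative deriv g w) (at w)"
      by (rule holomorphic_derivI[OF *(4) open_ball w])
    then have "((\<lambda>w. (w - z)^n * g w) has_field_derivative
        of_nat n * (w - z)^(n - 1) * g w + (w - z)^n * deriv g w) (at w)"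
      by (auto intro!: derivative_eq_intros)
    then show "(f has_field_derivative of_nat n * (w - z)^(n - 1) * g w + (w - z)^n * deriv g w) (at w)"
      by (rule has_field_derivative_transform_within_open[OF _ open_ball w]) (simp add: *(5))
  qed
  have "\<forall>\<^sub>F w in at z. w \<in> ball z r - {z}"
    using *(2) by (intro eventually_at_in_open) auto
  \<comment> \<open>Inserting \<open>f = (w - z)^n * g\<close> and cancelling
    \<open>(w - z)^n\<close> leaves an identity whose limit at \<open>z\<close> is
    \<open>n * g z = m * g z\<close>, with \<open>g z\<close> nonzero.\<close>
  with G have ev: "\<forall>\<^sub>F w in at z. of_nat n * g w + (w - z) * deriv g w = (m + (w - z) * a w) * g w"
  proof eventually_elim
    case (elim w)
    have "(w - z) * (w - z)^(n - 1) = (w - z)^n" using *(1) by (simp flip: power_Suc)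
    then have "(w - z)^n * (of_nat n * g w + (w - z) * deriv g w) = (w - z) * deriv f w"
      using elim(2) by (simp add: f' algebra_simps)
    also have "\<dots> = (w - z)^n * ((m + (w - z) * a w) * g w)"
      using elim by (simp add: *(5) algebra_simps)
    finally show ?case using elim(2) by simp
  qed
  have gc: "isCont g z" "isCont (deriv g) z"
    using *(4) holomorphic_deriv[OF *(4) open_ball] z
    by (metis analytic_at analytic_at_imp_isCont open_ball)+
  have "((\<lambda>w. of_nat n * g w + (w - z) * deriv g w) \<longlongrightarrow> of_nat n * g z + (z - z) * deriv g z) (at z)"
    by (intro tendsto_intros) (use gc in \<open>auto simp: isCont_def\<close>)
  moreover have "((\<lambda>w. (m + (w - z) * a w) * g w) \<longlongrightarrow> (m + (z - z) * a z) * g z) (at z)"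
    by (intro tendsto_intros) (use gc a in \<open>auto simp: isCont_def\<close>)
  then have "((\<lambda>w. of_nat n * g w + (w - z) * deriv g w) \<longlongrightarrow> (m + (z - z) * a z) * g z) (at z)"
    by (rule Lim_transform_eventually) (use ev in eventually_elim, simp)
  ultimately have "of_nat n * g z + (z - z) * deriv g z = (m + (z - z) * a z) * g z"
    by (intro tendsto_unique[of "at z"]) auto
  then have m: "m = of_nat n" using *(6)[OF z] by simp
  show ?thesis
  proof (rule that[OF *(1) m])
    assume "n = 1"
    then show "deriv f z \<noteq> 0" using f'[OF z] *(6)[OF z] by simp
  qed
qed

section \<open>The differential equation of \<open>wp\<close>, the addition formula and the zeros of
  \<open>wp - wp(p)\<close>\<close>

context upper_lattice
begin

lemma deriv_wp_periodic: "\<alpha> \<in> lattice \<tau> \<Longrightarrow> deriv (wp \<tau>) (z + \<alpha>) = deriv (wp \<tau>) z"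
  by (rule deriv_periodic) (rule wp_periodic)

lemma deriv_deriv_wp_periodic:
  "\<alpha> \<in> lattice \<tau> \<Longrightarrow> deriv (deriv (wp \<tau>)) (z + \<alpha>) = deriv (deriv (wp \<tau>)) z"
  by (rule deriv_periodic) (rule deriv_wp_periodic)

text \<open>At 0 the two terms \<open>6 / z^4\<close> cancel, and the cross term
  \<open>12 * wp_reg z / z^2\<close> is regular because \<open>wp_reg\<close> vanishes to second
  order. The value of \<open>c\<close> is left open: it cancels when the equation is used at both
  \<open>z\<close> and \<open>p\<close>.\<close>

lemma wp_second_derivative:
  obtains c where "\<And>z. z \<notin> lattice \<tau> \<Longrightarrow> deriv (deriv (wp \<tau>)) z = 6 * wp \<tau> z ^ 2 + c"
proof -
  define \<phi> where "\<phi> = (\<lambda>z. deriv (deriv (wp \<tau>)) z - 6 * wp \<tau> z ^ 2)"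
  have per: "\<phi> (z + \<alpha>) = \<phi> z" if "\<alpha> \<in> lattice \<tau>" for z \<alpha>
    by (simp add: \<phi>_def wp_periodic[OF that] deriv_deriv_wp_periodic[OF that])
  have an: "\<phi> analytic_on {z}" if "z \<notin> lattice \<tau>" for z
    unfolding \<phi>_def by (intro analytic_intros analytic_deriv wp_analytic that)
  have at0: "analytically_extendable \<phi> 0"
  proof -
    obtain v where v: "v analytic_on {0}" "\<And>w. wp_reg w = (w - 0)^2 * v w"
      using analytic_factor_double_zero[OF wp_reg_analytic wp_reg_0 deriv_wp_reg_0] by blast
    show ?thesis
    proof (rule analytically_extendableI)
      show "(\<lambda>w. deriv (deriv wp_reg) w - 12 * v w - 6 * wp_reg w ^ 2) analytic_on {0}"
        by (intro analytic_intros analytic_deriv wp_reg_analytic v)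
      show "\<forall>\<^sub>F w in at 0. \<phi> w = deriv (deriv wp_reg) w - 12 * v w - 6 * wp_reg w ^ 2"
        using eventually_notin_lattice[of 0]
      proof eventually_elim
        case (elim w)
        then have "w \<noteq> 0" by auto
        then have "6 * (1 / w^2 + wp_reg w)^2 = 6 / w^4 + 12 * v w + 6 * wp_reg w ^ 2"
          by (simp add: v(2) field_simps eval_nat_numeral)
        then show ?case by (simp add: \<phi>_def deriv_deriv_wp_eq_reg[OF elim] wp_eq_reg)
      qed
    qed
  qed
  have ext: "analytically_extendable \<phi> z" for z
  proof (cases "z \<in> lattice \<tau>")
    case True
    from analytically_extendable_shift[OF at0, of z] per[OF True] show ?thesis by simp
  qed (intro analytically_extendable_analytic an)
  obtain c where c: "\<And>z. \<forall>\<^sub>F w in at z. \<phi> w = c"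
    using elliptic_constant[OF per ext] by blast
  show ?thesis
  proof (rule that[of c])
    fix z assume "z \<notin> lattice \<tau>"
    from eventually_const_imp_eq[OF c an[OF this]]
    show "deriv (deriv (wp \<tau>)) z = 6 * wp \<tau> z ^ 2 + c" by (simp add: \<phi>_def algebra_simps)
  qed
qed

text \<open>The zero of \<open>f\<close> cancels the simple pole of the translated zeta function;
  quasi-periodicity moves that pole from an arbitrary lattice point to the origin.\<close>

lemma zeta_translate_times_zero:
  assumes "f analytic_on {z}" "z - w \<in> lattice \<tau> \<Longrightarrow> f z = 0"
  shows "analytically_extendable (\<lambda>x. wzeta \<tau> (x - w) * f x) z"
proof (cases "z - w \<in> lattice \<tau>")
  case False
  then have "(\<lambda>x. wzeta \<tau> (x - w)) analytic_on {z}"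
    using analytic_on_translate[of "wzeta \<tau>" z "- w"] wzeta_analytic[of "z - w"] by simp
  then show ?thesis by (intro analytically_extendable_analytic analytic_intros assms(1))
next
  case True
  obtain v where v: "v analytic_on {z}" "\<And>x. f x = (x - z) * v x"
    using analytic_factor_zero[OF assms(1) assms(2)[OF True]] by blast
  obtain \<eta> where \<eta>: "\<And>x. wzeta \<tau> (x + (z - w)) = wzeta \<tau> x + \<eta>"
    using wzeta_quasi_periodic[OF True] by blast
  have r: "(\<lambda>x. zeta_reg (x - z)) analytic_on {z}"
    using analytic_on_translate[of zeta_reg z "- z"] zeta_reg_analytic by simp
  show ?thesis
  proof (rule analytically_extendableI)
    show "(\<lambda>x. v x + (zeta_reg (x - z) + \<eta>) * f x) analytic_on {z}"
      by (intro analytic_intros v r assms(1))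
    have "\<forall>\<^sub>F x in at z. x \<noteq> z" by (simp add: eventually_at_filter)
    then show "\<forall>\<^sub>F x in at z. wzeta \<tau> (x - w) * f x = v x + (zeta_reg (x - z) + \<eta>) * f x"
    proof eventually_elim
      case (elim x)
      have "wzeta \<tau> (x - w) = 1 / (x - z) + zeta_reg (x - z) + \<eta>"
        using \<eta>[of "x - z"] by (simp add: wzeta_eq_reg)
      moreover have "1 / (x - z) * f x = v x" using elim by (simp add: v(2))
      ultimately show ?case by (simp only: distrib_right add.assoc)
    qed
  qed
qed

lemma wp_eq_iff_lattice: "z - w \<in> lattice \<tau> \<Longrightarrow> wp \<tau> z = wp \<tau> w"
  using wp_periodic[of "z - w" w] by simp

text \<open>The difference of the two sides is elliptic, since the quasi-periods enter with total
  weight \<open>1 + 1 - 2\<close>, and all its singularities are removable. Hence it is constant,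
  and being odd it is 0.\<close>

lemma wzeta_addition:
  assumes w: "w \<notin> lattice \<tau>" and z: "z \<notin> lattice \<tau>" "z - w \<notin> lattice \<tau>" "z + w \<notin> lattice \<tau>"
  shows "(wzeta \<tau> (z - w) + wzeta \<tau> (z + w) - 2 * wzeta \<tau> z) * (wp \<tau> z - wp \<tau> w) = deriv (wp \<tau>) z"
proof -
  define f where "f = (\<lambda>z. wp \<tau> z - wp \<tau> w)"
  define \<phi> where "\<phi> = (\<lambda>z. (wzeta \<tau> (z - w) + wzeta \<tau> (z + w) - 2 * wzeta \<tau> z) * f z - deriv (wp \<tau>) z)"
  have per: "\<phi> (z + \<alpha>) = \<phi> z" if \<alpha>: "\<alpha> \<in> lattice \<tau>" for z \<alpha>
  proof -
    obtain \<eta> where \<eta>: "\<And>x. wzeta \<tau> (x + \<alpha>) = wzeta \<tau> x + \<eta>"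
      using wzeta_quasi_periodic[OF \<alpha>] by blast
    have "wzeta \<tau> (z + \<alpha> - w) = wzeta \<tau> (z - w) + \<eta>" "wzeta \<tau> (z + \<alpha> + w) = wzeta \<tau> (z + w) + \<eta>"
      using \<eta>[of "z - w"] \<eta>[of "z + w"] by (simp_all add: algebra_simps)
    then show ?thesis
      by (simp add: \<phi>_def f_def wp_periodic[OF \<alpha>] deriv_wp_periodic[OF \<alpha>] \<eta>)
  qed
  have f_an: "f analytic_on {z}" if "z \<notin> lattice \<tau>" for z
    unfolding f_def by (intro analytic_intros wp_analytic that)
  have w': "- w \<notin> lattice \<tau>" using w by simp
  have at0: "analytically_extendable \<phi> 0"
  proof -
    define b where "b = (\<lambda>z. wzeta \<tau> (z - w) + wzeta \<tau> (z + w))"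
    \<comment> \<open>Adding \<open>2 * wp \<tau> w * z\<close> removes the linear Taylor term of
      the odd function \<open>b\<close>, so \<open>u\<close> vanishes to second order. The removed
      term later cancels the residue coming from \<open>(- 2 / t) * (- wp \<tau> w)\<close>.\<close>
    define u where "u = (\<lambda>z. b z + 2 * wp \<tau> w * z)"
    have b_an: "b analytic_on {0}"
      unfolding b_def using analytic_on_translate[of "wzeta \<tau>" 0 "- w"] analytic_on_translate[of "wzeta \<tau>" 0 w]
        wzeta_analytic[OF w] wzeta_analytic[OF w'] by (intro analytic_intros) auto
    have u_an: "u analytic_on {0}" unfolding u_def by (intro analytic_intros b_an)
    have u0: "u 0 = 0" by (simp add: u_def b_def wzeta_minus)
    have "((\<lambda>z. wzeta \<tau> (z - w)) has_field_derivative - wp \<tau> (- w) * 1) (at 0)"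
      by (rule DERIV_chain2[where g = "\<lambda>z. z - w"])
         (use wzeta_deriv[OF w'] in \<open>auto intro!: derivative_eq_intros\<close>)
    moreover have "((\<lambda>z. wzeta \<tau> (z + w)) has_field_derivative - wp \<tau> w * 1) (at 0)"
      by (rule DERIV_chain2[where g = "\<lambda>z. z + w"])
         (use wzeta_deriv[OF w] in \<open>auto intro!: derivative_eq_intros\<close>)
    ultimately have "(u has_field_derivative 0) (at 0)"
      unfolding u_def b_def by (auto intro!: derivative_eq_intros simp: wp_minus)
    then have u1: "deriv u 0 = 0" by (rule DERIV_imp_deriv)
    obtain v where v: "v analytic_on {0}" "\<And>x. u x = (x - 0)^2 * v x"
      using analytic_factor_double_zero[OF u_an u0 u1] by blast
    obtain x where x: "x analytic_on {0}" "\<And>t. zeta_reg t = (t - 0)^2 * x t"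
      using analytic_factor_double_zero[OF zeta_reg_analytic zeta_reg_0 deriv_zeta_reg_0] by blast
    obtain y where y: "y analytic_on {0}" "\<And>t. wp_reg t = (t - 0) * y t"
      using analytic_factor_zero[OF wp_reg_analytic wp_reg_0] by blast
    show ?thesis
    proof (rule analytically_extendableI)
      show "(\<lambda>t. v t - 2 * y t - 2 * x t + (b t - 2 * zeta_reg t) * (wp_reg t - wp \<tau> w) - deriv wp_reg t) analytic_on {0}"
        by (intro analytic_intros analytic_deriv wp_reg_analytic zeta_reg_analytic b_an v x y)
      show "\<forall>\<^sub>F t in at 0. \<phi> t =
          v t - 2 * y t - 2 * x t + (b t - 2 * zeta_reg t) * (wp_reg t - wp \<tau> w) - deriv wp_reg t"
        using eventually_notin_lattice[of 0]
      proof eventually_elim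
        case (elim t)
        then have t: "t \<noteq> 0" by auto
        have b: "b t = t^2 * v t - 2 * wp \<tau> w * t" using v(2)[of t] by (simp add: u_def algebra_simps)
        have "(b t - 2 / t - 2 * zeta_reg t) * (1 / t^2 + wp_reg t - wp \<tau> w) + 2 / t^3 =
            (b t / t^2 - 2 * (wp_reg t / t) - 2 * (zeta_reg t / t^2) + 2 * wp \<tau> w / t) + (b t - 2 * zeta_reg t) * (wp_reg t - wp \<tau> w)"
          using t by (simp add: field_simps eval_nat_numeral)
        also have "b t / t^2 = v t - 2 * wp \<tau> w / t" using t unfolding b by (simp add: field_simps power2_eq_square)
        also have "wp_reg t / t = y t" using t by (simp add: y(2))
        also have "zeta_reg t / t^2 = x t" using t by (simp add: x(2))
        finally have "(b t - 2 / t - 2 * zeta_reg t) * (1 / t^2 + wp_reg t - wp \<tau> w) + 2 / t^3 =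
            v t - 2 * y t - 2 * x t + (b t - 2 * zeta_reg t) * (wp_reg t - wp \<tau> w)" by simp
        moreover have "\<phi> t = (b t - 2 / t - 2 * zeta_reg t) * (1 / t^2 + wp_reg t - wp \<tau> w) + 2 / t^3 - deriv wp_reg t"
          by (simp add: \<phi>_def f_def b_def wp_eq_reg[of t] wzeta_eq_reg[of t] deriv_wp_eq_reg[OF elim] algebra_simps)
        ultimately show ?case by simp
      qed
    qed
  qed
  have ext: "analytically_extendable \<phi> z" for z
  proof (cases "z \<in> lattice \<tau>")
    case True
    from analytically_extendable_shift[OF at0, of z] per[OF True] show ?thesis by simp
  next
    case False
    \<comment> \<open>Treating the two products separately also covers the case in which
      \<open>w\<close> and \<open>- w\<close> agree modulo the lattice.\<close>
    have "analytically_extendable (\<lambda>z. wzeta \<tau> (z - w) * f z) z"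
      by (rule zeta_translate_times_zero[OF f_an[OF False]]) (simp add: f_def wp_eq_iff_lattice)
    moreover have "analytically_extendable (\<lambda>z. wzeta \<tau> (z - (- w)) * f z) z"
      by (rule zeta_translate_times_zero[OF f_an[OF False]])
         (use wp_eq_iff_lattice[of z "- w"] in \<open>simp add: f_def wp_minus\<close>)
    moreover have "analytically_extendable (\<lambda>z. 2 * wzeta \<tau> z * f z + deriv (wp \<tau>) z) z"
      by (intro analytically_extendable_analytic analytic_intros analytic_deriv wzeta_analytic
          wp_analytic f_an False)
    ultimately have "analytically_extendable (\<lambda>z. wzeta \<tau> (z - w) * f z + wzeta \<tau> (z - (- w)) * f z
        - (2 * wzeta \<tau> z * f z + deriv (wp \<tau>) z)) z"
      by (rule analytically_extendable_diff[OF analytically_extendable_add])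
    then show ?thesis by (simp add: \<phi>_def algebra_simps)
  qed
  obtain c where c: "\<And>z. \<forall>\<^sub>F x in at z. \<phi> x = c"
    using elliptic_constant[OF per ext] by blast
  have odd: "\<phi> (- x) = - \<phi> x" if "x \<notin> lattice \<tau>" for x
  proof -
    have "wzeta \<tau> (- x - w) = - wzeta \<tau> (x + w)" "wzeta \<tau> (- x + w) = - wzeta \<tau> (x - w)"
      by (simp_all flip: wzeta_minus)
    then show ?thesis
      by (simp add: \<phi>_def f_def wp_minus wzeta_minus deriv_wp_minus[OF that] algebra_simps)
  qed
  have "filterlim uminus (at (0 :: complex)) (at 0)"
    by (intro filterlim_atI tendsto_eq_intros) (auto simp: eventually_at_filter)
  from eventually_compose_filterlim[OF c[of 0] this] have "\<forall>\<^sub>F x in at 0. \<phi> (- x) = c" .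
  with c[of 0] eventually_notin_lattice[of 0]
  have "\<forall>\<^sub>F x in at 0. \<phi> x = c \<and> \<phi> (- x) = c \<and> x \<notin> lattice \<tau>"
    by eventually_elim simp
  then obtain x where "\<phi> x = c" "\<phi> (- x) = c" "x \<notin> lattice \<tau>"
    using eventually_happens'[of "at (0 :: complex)"] by auto
  then have "c = - c" using odd[of x] by simp
  then have "c = 0" by simp
  have "\<phi> analytic_on {z}"
    unfolding \<phi>_def using z analytic_on_translate[of "wzeta \<tau>" z "- w"] analytic_on_translate[of "wzeta \<tau>" z w]
    by (intro analytic_intros analytic_deriv wzeta_analytic wp_analytic f_an) (auto simp: wzeta_analytic)
  from eventually_const_imp_eq[OF c this] show ?thesis by (simp add: \<phi>_def f_def \<open>c = 0\<close>)
qed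

lemma countable_lattice: "countable (lattice \<tau>)"
proof -
  have "lattice \<tau> = (\<lambda>(a, b). of_int a + of_int b * \<tau>) ` (UNIV :: (int \<times> int) set)"
    by (auto simp: lattice_def)
  then show ?thesis by simp
qed

text \<open>Removing a countable closed set leaves the plane connected. Connectedness is what gives
  a zero of a nonconstant function a finite order.\<close>

lemma connected_Compl_lattice: "connected (- lattice \<tau>)"
  using connected_open_diff_countable[of "UNIV :: complex set" "lattice \<tau>"] countable_lattice
  by (simp add: Compl_eq_Diff_UNIV connected_UNIV)

text \<open>If \<open>wp\<close> were constant, \<open>z^2 * c - z^2 * wp_reg z\<close> would be 1
  near 0, yet it is analytic and vanishes at 0.\<close>

lemma wp_nonconstant: "\<not> wp \<tau> constant_on - lattice \<tau>"
proof
  assume "wp \<tau> constant_on - lattice \<tau>"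
  then obtain c where c: "\<And>z. z \<notin> lattice \<tau> \<Longrightarrow> wp \<tau> z = c" by (auto simp: constant_on_def)
  have "\<forall>\<^sub>F z in at 0. z^2 * c - z^2 * wp_reg z = 1"
    using eventually_notin_lattice[of 0]
  proof eventually_elim
    case (elim z)
    then have "z \<noteq> 0" by auto
    then show ?case using c[OF elim] by (simp add: wp_eq_reg field_simps)
  qed
  moreover have "(\<lambda>z. z^2 * c - z^2 * wp_reg z) analytic_on {0}"
    by (intro analytic_intros wp_reg_analytic)
  ultimately show False using eventually_const_imp_eq by fastforce
qed

text \<open>By the addition formula the logarithmic derivative of \<open>wp - wp(p)\<close> is the
  zeta combination, so its residue at any zero can be read off from zeta and must be a positive
  integer.\<close>

lemma wp_zero_order:
  assumes p: "p \<notin> lattice \<tau>" and z: "z \<notin> lattice \<tau>" and f: "wp \<tau> z = wp \<tau> p"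
    and a: "a analytic_on {z}"
    and G: "\<forall>\<^sub>F w in at z. (w - z) * (wzeta \<tau> (w - p) + wzeta \<tau> (w + p) - 2 * wzeta \<tau> w) = m + (w - z) * a w"
  obtains n where "n > 0" "m = of_nat n" "n = 1 \<Longrightarrow> deriv (wp \<tau>) z \<noteq> 0"
proof -
  define h where "h = (\<lambda>w. wp \<tau> w - wp \<tau> p)"
  have h': "deriv h w = deriv (wp \<tau>) w" if "w \<notin> lattice \<tau>" for w
    unfolding h_def by (rule DERIV_imp_deriv) (auto intro!: derivative_eq_intros wp_has_deriv that)
  have hol: "h holomorphic_on - lattice \<tau>"
    unfolding h_def by (intro holomorphic_intros wp_holomorphic)
  have nc: "\<not> h constant_on - lattice \<tau>"
  proof
    assume "h constant_on - lattice \<tau>"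
    then obtain c where "\<And>w. w \<notin> lattice \<tau> \<Longrightarrow> wp \<tau> w = c + wp \<tau> p"
      by (auto simp: constant_on_def h_def algebra_simps)
    then show False using wp_nonconstant by (auto simp: constant_on_def)
  qed
  have shift: "\<forall>\<^sub>F w in at z. w + x \<notin> lattice \<tau>" for x
  proof -
    have "at (z + x) = filtermap (\<lambda>w. w + x) (at z)" using filtermap_at_shift[of "- x" z] by simp
    then show ?thesis using eventually_notin_lattice[of "z + x"] by (simp add: eventually_filtermap)
  qed
  have ev: "\<forall>\<^sub>F w in at z. (w - z) * deriv h w = (m + (w - z) * a w) * h w"
    using G shift[of 0] shift[of "- p"] shift[of p]
  proof eventually_elim
    case (elim w)
    then have w: "w \<notin> lattice \<tau>" "w - p \<notin> lattice \<tau>" "w + p \<notin> lattice \<tau>" by simp_all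
    have "deriv h w = (wzeta \<tau> (w - p) + wzeta \<tau> (w + p) - 2 * wzeta \<tau> w) * h w"
      unfolding h'[OF w(1)] wzeta_addition[OF p w, symmetric] by (simp add: h_def)
    then show ?case using elim(1) by (simp add: mult.assoc flip: elim(1))
  qed
  show ?thesis
  proof (rule order_from_log_derivative[OF hol open_Compl_lattice connected_Compl_lattice _ _ nc ev])
    show "z \<in> - lattice \<tau>" "h z = 0" using z f by (auto simp: h_def)
    show "isCont a z" by (rule analytic_at_imp_isCont[OF a])
  next
    fix n assume "n > 0" "m = of_nat n" "n = 1 \<Longrightarrow> deriv h z \<noteq> 0"
    then show thesis using that h'[OF z] by auto
  qed
qed

text \<open>Away from the poles of the zeta combination the residue is 0, which is not the order of
  a zero.\<close>

lemma wp_neq: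
  assumes p: "p \<notin> lattice \<tau>" and z: "z \<notin> lattice \<tau>" "z - p \<notin> lattice \<tau>" "z + p \<notin> lattice \<tau>"
  shows "wp \<tau> z \<noteq> wp \<tau> p"
proof
  assume eq: "wp \<tau> z = wp \<tau> p"
  have "(\<lambda>w. wzeta \<tau> (w - p) + wzeta \<tau> (w + p) - 2 * wzeta \<tau> w) analytic_on {z}"
    using z analytic_on_translate[of "wzeta \<tau>" z "- p"] analytic_on_translate[of "wzeta \<tau>" z p]
    by (intro analytic_intros wzeta_analytic) (auto simp: wzeta_analytic)
  note an = this
  have ev: "\<forall>\<^sub>F w in at z. (w - z) * (wzeta \<tau> (w - p) + wzeta \<tau> (w + p) - 2 * wzeta \<tau> w) =
      0 + (w - z) * (wzeta \<tau> (w - p) + wzeta \<tau> (w + p) - 2 * wzeta \<tau> w)"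
    by simp
  obtain n where "n > 0" "(0 :: complex) = of_nat n"
    by (rule wp_zero_order[OF p z(1) eq an ev])
  then show False by simp
qed

text \<open>Since \<open>2 * p\<close> is not a lattice point, only
  \<open>wzeta \<tau> (w - p)\<close> has a pole at \<open>p\<close>. The residue is 1, so the zero
  is simple.\<close>

lemma deriv_wp_nonzero:
  assumes p: "2 * p \<notin> lattice \<tau>"
  shows "deriv (wp \<tau>) p \<noteq> 0"
proof -
  have pp: "p + p \<notin> lattice \<tau>" using p by (metis mult_2)
  then have p': "p \<notin> lattice \<tau>" using lattice_add[of p \<tau> p] by blast
  have an: "(\<lambda>w. zeta_reg (w - p) + wzeta \<tau> (w + p) - 2 * wzeta \<tau> w) analytic_on {p}"
    using pp p' analytic_on_translate[of zeta_reg p "- p"] analytic_on_translate[of "wzeta \<tau>" p p]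
    by (intro analytic_intros wzeta_analytic) (auto simp: wzeta_analytic zeta_reg_analytic)
  have "\<forall>\<^sub>F w in at p. w \<noteq> p" by (simp add: eventually_at_filter)
  then have ev: "\<forall>\<^sub>F w in at p. (w - p) * (wzeta \<tau> (w - p) + wzeta \<tau> (w + p) - 2 * wzeta \<tau> w) =
      1 + (w - p) * (zeta_reg (w - p) + wzeta \<tau> (w + p) - 2 * wzeta \<tau> w)"
    by eventually_elim (simp add: wzeta_eq_reg[of "_ - p"] field_simps)
  show ?thesis
  proof (rule wp_zero_order[OF p' p' refl an ev])
    fix n assume n: "(1 :: complex) = of_nat n" "n = 1 \<Longrightarrow> deriv (wp \<tau>) p \<noteq> 0"
    from n(1) have "n = 1" by (metis of_nat_1 of_nat_eq_iff)
    then show ?thesis by (rule n(2))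
  qed
qed

end

section \<open>The operators\<close>

lemma deriv_2: "(deriv ^^ 2) f = deriv (deriv f)"
  by (simp add: numeral_2_eq_2)

section \<open>The logarithmic derivative \<open>g\<close> and the rewritten potential\<close>

locale generic_parameter = upper_lattice +
  fixes p :: complex
  assumes p: "2 * p \<notin> lattice \<tau>"
begin

lemma p_notin: "p \<notin> lattice \<tau>"
  using p lattice_add[of p \<tau> p] by (metis mult_2)

lemma nonsingularD:
  assumes "z \<notin> singular_points \<tau> p"
  shows "z \<notin> lattice \<tau>" "z - p \<notin> lattice \<tau>" "z + p \<notin> lattice \<tau>"
  using assms by (auto simp: singular_points_def)

lemma open_nonsingular: "open (- singular_points \<tau> p)"
proof -
  have "- singular_points \<tau> p =
      - lattice \<tau> \<inter> (\<lambda>z. z - p) -` (- lattice \<tau>) \<inter> (\<lambda>z. z + p) -` (- lattice \<tau>)"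
    by (auto simp: singular_points_def)
  also have "open \<dots>"
    by (intro open_Int open_vimage open_Compl_lattice continuous_intros)
  finally show ?thesis .
qed

context
  fixes z assumes z: "z \<notin> singular_points \<tau> p"
begin

lemma f_fun_nonzero: "f_fun \<tau> p z \<noteq> 0"
  using wp_neq[OF p_notin nonsingularD[OF z]] by (simp add: f_fun_def)

lemma f_fun_deriv: "(f_fun \<tau> p has_field_derivative deriv (wp \<tau>) z) (at z)"
  unfolding f_fun_def[abs_def]
  by (auto intro!: derivative_eq_intros wp_has_deriv nonsingularD[OF z])

lemma f_fun_analytic: "f_fun \<tau> p analytic_on {z}"
  unfolding f_fun_def[abs_def] by (intro analytic_intros wp_analytic nonsingularD[OF z])

lemma deriv_f_fun: "deriv (f_fun \<tau> p) z = deriv (wp \<tau>) z"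
  by (rule DERIV_imp_deriv[OF f_fun_deriv])

lemma g_fun_eq: "g_fun \<tau> p z = deriv (wp \<tau>) z / f_fun \<tau> p z"
  by (simp add: g_fun_def deriv_f_fun)

lemma g_fun_eq_zeta: "g_fun \<tau> p z = wzeta \<tau> (z + p) + wzeta \<tau> (z - p) - 2 * wzeta \<tau> z"
  using wzeta_addition[OF p_notin nonsingularD[OF z]] f_fun_nonzero
  by (simp add: g_fun_eq f_fun_def field_simps)

lemma g_fun_analytic: "g_fun \<tau> p analytic_on {z}"
  unfolding g_fun_def[abs_def]
  by (intro analytic_intros analytic_deriv f_fun_analytic) (use f_fun_nonzero in auto)

lemma g_fun_has_deriv: "(g_fun \<tau> p has_field_derivative deriv (g_fun \<tau> p) z) (at z)"
  using g_fun_analytic analytic_on_imp_differentiable_at field_differentiable_derivI by blast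

end

context
  fixes z assumes z: "z \<notin> singular_points \<tau> p"
begin

lemma deriv_g_fun:
  "deriv (g_fun \<tau> p) z = deriv (deriv (wp \<tau>)) z / f_fun \<tau> p z - g_fun \<tau> p z ^ 2"
proof (rule DERIV_imp_deriv)
  note nz = f_fun_nonzero[OF z]
  have "(deriv (wp \<tau>) has_field_derivative deriv (deriv (wp \<tau>)) z) (at z)"
    by (rule holomorphic_derivI[OF holomorphic_deriv[OF wp_holomorphic open_Compl_lattice] open_Compl_lattice])
       (use nonsingularD[OF z] in auto)
  from DERIV_divide[OF this f_fun_deriv[OF z] nz]
  have "((\<lambda>z. deriv (wp \<tau>) z / f_fun \<tau> p z) has_field_derivative
      deriv (deriv (wp \<tau>)) z / f_fun \<tau> p z - g_fun \<tau> p z ^ 2) (at z)"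
    using nz by (simp add: g_fun_eq[OF z] power2_eq_square diff_divide_distrib)
  then show "(g_fun \<tau> p has_field_derivative
      deriv (deriv (wp \<tau>)) z / f_fun \<tau> p z - g_fun \<tau> p z ^ 2) (at z)"
    by (rule has_field_derivative_transform_within_open[OF _ open_nonsingular])
       (use z in \<open>auto simp: g_fun_eq\<close>)
qed

text \<open>This is the derivative of the zeta formula for \<open>g\<close>.\<close>

lemma wp_sum_eq: "wp \<tau> (z + p) + wp \<tau> (z - p) = 2 * wp \<tau> z - deriv (g_fun \<tau> p) z"
proof -
  have "((\<lambda>x. wzeta \<tau> (x + p)) has_field_derivative - wp \<tau> (z + p) * 1) (at z)"
    by (rule DERIV_chain2[where g = "\<lambda>x. x + p"])
       (use wzeta_deriv[OF nonsingularD(3)[OF z]] in \<open>auto intro!: derivative_eq_intros\<close>)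
  moreover have "((\<lambda>x. wzeta \<tau> (x - p)) has_field_derivative - wp \<tau> (z - p) * 1) (at z)"
    by (rule DERIV_chain2[where g = "\<lambda>x. x - p"])
       (use wzeta_deriv[OF nonsingularD(2)[OF z]] in \<open>auto intro!: derivative_eq_intros\<close>)
  ultimately have "((\<lambda>x. wzeta \<tau> (x + p) + wzeta \<tau> (x - p) - 2 * wzeta \<tau> x) has_field_derivative
      - wp \<tau> (z + p) - wp \<tau> (z - p) + 2 * wp \<tau> z) (at z)"
    using wzeta_deriv[OF nonsingularD(1)[OF z]] by (auto intro!: derivative_eq_intros)
  then have "(g_fun \<tau> p has_field_derivative - wp \<tau> (z + p) - wp \<tau> (z - p) + 2 * wp \<tau> z) (at z)"
    by (rule has_field_derivative_transform_within_open[OF _ open_nonsingular])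
       (use z in \<open>auto simp: g_fun_eq_zeta\<close>)
  then show ?thesis by (simp add: DERIV_imp_deriv)
qed

text \<open>The addition formula with \<open>z\<close> and \<open>p\<close> exchanged; the exchange
  turns \<open>f\<close> into \<open>- f\<close> and makes \<open>wzeta \<tau> (p - z)\<close> equal
  to \<open>- wzeta \<tau> (z - p)\<close>.\<close>

lemma zeta_difference_eq:
  "wzeta \<tau> (z + p) - wzeta \<tau> (z - p) = 2 * wzeta \<tau> p - deriv (wp \<tau>) p / f_fun \<tau> p z"
proof -
  have "p - z \<notin> lattice \<tau>" "p + z \<notin> lattice \<tau>"
    using nonsingularD[OF z] lattice_uminus_iff[of "z - p" \<tau>] by (simp_all add: add.commute)
  from wzeta_addition[OF nonsingularD(1)[OF z] p_notin this]
  have "(- wzeta \<tau> (z - p) + wzeta \<tau> (z + p) - 2 * wzeta \<tau> p) * - f_fun \<tau> p z = deriv (wp \<tau>) p"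
    using wzeta_minus[of "z - p"] by (simp add: f_fun_def add.commute)
  then show ?thesis using f_fun_nonzero[OF z] by (simp add: field_simps)
qed

text \<open>Everything reduces to \<open>wp''(p) / f\<close>. As
  \<open>wp''(z) / f = g' + g^2\<close> and \<open>wp''(z) - wp''(p) = 6 * (a + b) * f\<close>, it
  equals \<open>g' + g^2 - 6 * (a + b)\<close>, free of the unknown \<open>c\<close>.\<close>

lemma gle_potential_eq:
  "gle_potential n p T \<tau> z = of_nat (n * (n + 1)) * f_fun \<tau> p z
     + (T + g_fun \<tau> p z / 2)^2 - deriv (g_fun \<tau> p) z / 2"
proof -
  obtain c where c: "\<And>z. z \<notin> lattice \<tau> \<Longrightarrow> deriv (deriv (wp \<tau>)) z = 6 * wp \<tau> z ^ 2 + c"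
    using wp_second_derivative by blast
  define a b f g g' N where "a = wp \<tau> z" and "b = wp \<tau> p" and "f = f_fun \<tau> p z" and
    "g = g_fun \<tau> p z" and "g' = deriv (g_fun \<tau> p) z" and "N = (of_nat (n * (n + 1)) :: complex)"
  note defs = this
  have f: "f \<noteq> 0" using f_fun_nonzero[OF z] by (simp add: defs)
  have fab: "f = a - b" by (simp add: defs f_fun_def)
  have g': "g' = (6 * a^2 + c) / f - g^2"
    using deriv_g_fun c[OF nonsingularD(1)[OF z]] by (simp add: defs)
  have "(6 * a^2 + c) / f - (6 * b^2 + c) / f = 6 * (a + b) * (f / f)"
    unfolding diff_divide_distrib[symmetric] times_divide_eq_right fab
    by (rule arg_cong[where f = "\<lambda>x. x / _"]) (simp add: algebra_simps power2_eq_square)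
  then have key: "(6 * b^2 + c) / f = g' + g^2 - 6 * (a + b)"
    using f by (simp add: g' algebra_simps)
  have p2: "deriv (deriv (wp \<tau>)) p = 6 * b^2 + c" using c[OF p_notin] by (simp add: defs)
  have nz: "deriv (wp \<tau>) p \<noteq> 0" by (rule deriv_wp_nonzero[OF p])
  have "gle_potential n p T \<tau> z = N * a + 3/4 * (2 * a - g') + T * g
      - (6 * b^2 + c) / (4 * deriv (wp \<tau>) p) * (2 * wzeta \<tau> p - deriv (wp \<tau>) p / f)
      + (T^2 + (6 * b^2 + c) / (2 * deriv (wp \<tau>) p) * wzeta \<tau> p - N * b + 3/2 * b)"
    unfolding gle_potential_def gle_constant_def deriv_2 p2 wp_sum_eq zeta_difference_eq
    by (simp add: defs g_fun_eq_zeta[OF z] algebra_simps power2_eq_square)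
  \<comment> \<open>The part with \<open>wzeta \<tau> p\<close> is exactly the one in the constant
    \<open>B\<close> and cancels; the rest has lost the factor \<open>wp'(p)\<close>.\<close>
  also have "(6 * b^2 + c) / (4 * deriv (wp \<tau>) p) * (2 * wzeta \<tau> p - deriv (wp \<tau>) p / f) =
      (6 * b^2 + c) / (2 * deriv (wp \<tau>) p) * wzeta \<tau> p - (6 * b^2 + c) / f / 4"
    using nz f by (simp add: field_simps)
  finally have "gle_potential n p T \<tau> z = N * a + 3/4 * (2 * a - g') + T * g
      + (g' + g^2 - 6 * (a + b)) / 4 + (T^2 - N * b + 3/2 * b)"
    unfolding key by simp
  \<comment> \<open>The terms \<open>3/2 * a\<close>, \<open>- 3/2 * (a + b)\<close> and
    \<open>3/2 * b\<close> cancel, and \<open>- 3/4 + 1/4\<close> gives the coefficient of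
    \<open>g'\<close>.\<close>
  also have "\<dots> = N * f + (T + g / 2)^2 - g' / 2"
    unfolding fab by (simp add: field_simps power2_eq_square)
  finally show ?thesis by (simp add: defs)
qed

end

end

section \<open>The two operators as the halves of a first-order system\<close>

locale branch_data = generic_parameter +
  fixes n :: nat and T :: complex and U :: "complex set" and h :: "complex \<Rightarrow> complex"
  assumes n: "n \<ge> 1" and U: "open U" "U \<inter> singular_points \<tau> p = {}"
    and h: "h_branch \<tau> p U h"
begin

abbreviation "N \<equiv> of_nat (n * (n + 1)) :: complex"
abbreviation "f \<equiv> f_fun \<tau> p"
abbreviation "g \<equiv> g_fun \<tau> p"
abbreviation "lame_solutions \<equiv> solution_space (lame_potential n (T^2 - N * wp \<tau> p) \<tau>) U"
abbreviation "gle_solutions \<equiv> solution_space (gle_potential n p T \<tau>) U"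

lemma N_nonzero: "N \<noteq> 0"
  using n unfolding of_nat_eq_0_iff by simp

lemma nonsingular: "z \<in> U \<Longrightarrow> z \<notin> singular_points \<tau> p"
  using U(2) by blast

lemma h_holomorphic: "h holomorphic_on U" and h_square: "z \<in> U \<Longrightarrow> h z ^ 2 = 1 / f z"
  using h by (auto simp: h_branch_def)

lemma h_square_f: "z \<in> U \<Longrightarrow> h z * h z * f z = 1"
  using h_square[of z] f_fun_nonzero[OF nonsingular, of z] by (simp add: power2_eq_square)

lemma h_deriv:
  assumes z: "z \<in> U"
  shows "(h has_field_derivative - (g z / 2) * h z) (at z)"
proof -
  have f: "f z \<noteq> 0" by (rule f_fun_nonzero[OF nonsingular[OF z]])
  have h': "(h has_field_derivative deriv h z) (at z)"
    by (rule holomorphic_derivI[OF h_holomorphic U(1) z])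
  have "((\<lambda>w. h w * h w * f w) has_field_derivative
      2 * h z * deriv h z * f z + h z * h z * deriv (wp \<tau>) z) (at z)"
    using h' f_fun_deriv[OF nonsingular[OF z]]
    by (auto intro!: derivative_eq_intros simp: algebra_simps)
  then have "((\<lambda>w. 1) has_field_derivative
      2 * h z * deriv h z * f z + h z * h z * deriv (wp \<tau>) z) (at z)"
    by (rule has_field_derivative_transform_within_open[OF _ U(1) z]) (simp add: h_square_f)
  then have "2 * h z * deriv h z * f z + h z * h z * deriv (wp \<tau>) z = 0"
    by (rule DERIV_unique) (rule DERIV_const)
  moreover have hz: "h z \<noteq> 0" using h_square_f[OF z] by auto
  ultimately have "h z * (2 * deriv h z * f z + h z * deriv (wp \<tau>) z) = 0" by (simp add: algebra_simps)
  then have "2 * deriv h z * f z + h z * deriv (wp \<tau>) z = 0" using hz by simp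
  then have "deriv h z = - (g z / 2) * h z"
    unfolding g_fun_eq[OF nonsingular[OF z]] using f by (simp add: field_simps add_eq_0_iff)
  with h' show ?thesis by simp
qed

lemma g_has_deriv: "z \<in> U \<Longrightarrow> (g has_field_derivative deriv g z) (at z)"
  by (rule g_fun_has_deriv[OF nonsingular])

lemma f_deriv: "z \<in> U \<Longrightarrow> (f has_field_derivative g z * f z) (at z)"
  using f_fun_deriv[OF nonsingular, of z] f_fun_nonzero[OF nonsingular, of z]
    g_fun_eq[OF nonsingular, of z] by simp

lemma lame_solution_derivs:
  assumes "y \<in> lame_solutions" "z \<in> U"
  shows "(y has_field_derivative deriv y z) (at z)"
    and "(deriv y has_field_derivative (N * f z + T^2) * y z) (at z)"
proof -
  have hol: "y holomorphic_on U" using assms(1) by (simp add: solution_space_def)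
  show "(y has_field_derivative deriv y z) (at z)"
    by (rule holomorphic_derivI[OF hol U(1) assms(2)])
  have "deriv (deriv y) z = (N * f z + T^2) * y z"
    using assms by (simp add: solution_space_def deriv_2 lame_potential_def f_fun_def algebra_simps)
  with holomorphic_derivI[OF holomorphic_deriv[OF hol U(1)] U(1) assms(2)]
  show "(deriv y has_field_derivative (N * f z + T^2) * y z) (at z)" by simp
qed

lemma gle_solution_derivs:
  assumes "v \<in> gle_solutions" "z \<in> U"
  shows "(v has_field_derivative deriv v z) (at z)"
    and "(deriv v has_field_derivative (N * f z + (T + g z / 2)^2 - deriv g z / 2) * v z) (at z)"
proof -
  have hol: "v holomorphic_on U" using assms(1) by (simp add: solution_space_def)
  show "(v has_field_derivative deriv v z) (at z)"
    by (rule holomorphic_derivI[OF hol U(1) assms(2)])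
  have "deriv (deriv v) z = (N * f z + (T + g z / 2)^2 - deriv g z / 2) * v z"
    using assms gle_potential_eq[OF nonsingular[OF assms(2)]] by (simp add: solution_space_def deriv_2)
  with holomorphic_derivI[OF holomorphic_deriv[OF hol U(1)] U(1) assms(2)]
  show "(deriv v has_field_derivative (N * f z + (T + g z / 2)^2 - deriv g z / 2) * v z) (at z)" by simp
qed

text \<open>On the open set \<open>U\<close> the explicit \<open>v'\<close> agrees with
  \<open>deriv v\<close> and may be differentiated in its place, so the second derivative is reached
  by two first-order computations.\<close>

lemma solution_spaceI:
  assumes "\<And>z. z \<in> U \<Longrightarrow> (v has_field_derivative v' z) (at z)"
    and "\<And>z. z \<in> U \<Longrightarrow> (v' has_field_derivative q z * v z) (at z)"
    and "\<And>z. z \<notin> U \<Longrightarrow> v z = 0"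
  shows "v \<in> solution_space q U"
proof -
  have "(deriv v has_field_derivative q z * v z) (at z)" if "z \<in> U" for z
    by (rule has_field_derivative_transform_within_open[OF assms(2)[OF that] U(1) that])
       (simp add: DERIV_imp_deriv[OF assms(1)])
  then have "(deriv ^^ 2) v z = q z * v z" if "z \<in> U" for z
    using that by (simp add: deriv_2 DERIV_imp_deriv)
  moreover have "v holomorphic_on U" using assms(1) by (auto simp: holomorphic_on_open[OF U(1)])
  ultimately show ?thesis using assms(3) by (simp add: solution_space_def)
qed

text \<open>By the Lame equation \<open>h * (y'' - T * y')\<close> is \<open>N * h * f * y\<close>
  minus \<open>T\<close> times the image, and \<open>h' = - (g / 2) * h\<close> supplies the
  remaining multiple of the image.\<close>

lemma op_D_deriv:
  assumes y: "y \<in> lame_solutions" and z: "z \<in> U"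
  shows "(op_D T U h y has_field_derivative N * (h z * f z * y z) - (T + g z / 2) * op_D T U h y z) (at z)"
proof -
  note d = lame_solution_derivs[OF y z] h_deriv[OF z]
  have "((\<lambda>z. h z * (deriv y z - T * y z)) has_field_derivative
      N * (h z * f z * y z) - (T + g z / 2) * op_D T U h y z) (at z)"
    using z by (auto intro!: derivative_eq_intros d simp: op_D_def algebra_simps power2_eq_square)
  then show ?thesis
    by (rule has_field_derivative_transform_within_open[OF _ U(1) z]) (simp add: op_D_def)
qed

lemma op_E_op_D:
  assumes y: "y \<in> lame_solutions"
  shows "op_E n \<tau> p T U h (op_D T U h y) = y"
proof
  fix z
  show "op_E n \<tau> p T U h (op_D T U h y) z = y z"
  proof (cases "z \<in> U")
    case True
    have "op_E n \<tau> p T U h (op_D T U h y) z = (h z / N) * (N * (h z * f z * y z))"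
      using True by (simp add: op_E_def DERIV_imp_deriv[OF op_D_deriv[OF y True]])
    also have "\<dots> = h z * h z * f z * y z" using N_nonzero by simp
    finally show ?thesis by (simp add: h_square_f[OF True])
  qed (use y in \<open>simp add: op_E_def solution_space_def\<close>)
qed

lemma op_D_in:
  assumes y: "y \<in> lame_solutions"
  shows "op_D T U h y \<in> gle_solutions"
proof (rule solution_spaceI)
  let ?v = "op_D T U h y"
  fix z assume z: "z \<in> U"
  show "(?v has_field_derivative N * (h z * f z * y z) - (T + g z / 2) * ?v z) (at z)"
    by (rule op_D_deriv[OF y z])
  have v: "?v z = h z * (deriv y z - T * y z)" using z by (simp add: op_D_def)
  \<comment> \<open>\<open>h * f\<close> is the reciprocal of \<open>h\<close>, so its logarithmic
    derivative is \<open>g / 2\<close>. The terms in \<open>y\<close> and \<open>y'\<close> then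
    combine to \<open>N * h * f * (y' - T * y)\<close>, that is, \<open>N * f\<close> times the
    image.\<close>
  have "((\<lambda>z. N * (h z * f z * y z) - (T + g z / 2) * ?v z) has_field_derivative
      N * (g z / 2 * (h z * f z) * y z + h z * f z * deriv y z)
      - (deriv g z / 2 * ?v z + (T + g z / 2) * (N * (h z * f z * y z) - (T + g z / 2) * ?v z))) (at z)"
    by (auto intro!: derivative_eq_intros h_deriv[OF z] f_deriv[OF z] lame_solution_derivs[OF y z]
        op_D_deriv[OF y z] g_has_deriv[OF z] simp: field_simps)
  also have "N * (g z / 2 * (h z * f z) * y z + h z * f z * deriv y z)
      - (deriv g z / 2 * ?v z + (T + g z / 2) * (N * (h z * f z * y z) - (T + g z / 2) * ?v z)) =
      (N * f z + (T + g z / 2)^2 - deriv g z / 2) * ?v z"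
    unfolding v by (simp add: field_simps power2_eq_square)
  finally show "((\<lambda>z. N * (h z * f z * y z) - (T + g z / 2) * ?v z) has_field_derivative
      gle_potential n p T \<tau> z * ?v z) (at z)"
    by (simp only: gle_potential_eq[OF nonsingular[OF z]])
qed (simp add: op_D_def)

text \<open>The term \<open>- g' / 2\<close> of the potential cancels the derivative of
  \<open>T + g / 2\<close>, and the factor \<open>h\<close> lowers \<open>T + g / 2\<close> to
  \<open>T\<close>.\<close>

lemma op_E_deriv:
  assumes v: "v \<in> gle_solutions" and z: "z \<in> U"
  shows "(op_E n \<tau> p T U h v has_field_derivative T * op_E n \<tau> p T U h v z + h z * f z * v z) (at z)"
proof -
  let ?k = "T + g z / 2" and ?v' = "deriv v z"
  note d = gle_solution_derivs[OF v z] h_deriv[OF z] g_has_deriv[OF z]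
  have "((\<lambda>z. deriv v z + (T + g z / 2) * v z) has_field_derivative
      (N * f z + ?k^2 - deriv g z / 2) * v z + (deriv g z / 2 * v z + ?k * ?v')) (at z)"
    by (auto intro!: derivative_eq_intros d simp: algebra_simps)
  from DERIV_mult[OF d(3) this] have "((\<lambda>z. h z * (deriv v z + (T + g z / 2) * v z)) has_field_derivative
      - (g z / 2) * h z * (?v' + ?k * v z) +
      ((N * f z + ?k^2 - deriv g z / 2) * v z + (deriv g z / 2 * v z + ?k * ?v')) * h z) (at z)" .
  from DERIV_cdivide[OF this, of N] have "((\<lambda>z. h z / N * (deriv v z + (T + g z / 2) * v z)) has_field_derivative
      (- (g z / 2) * h z * (?v' + ?k * v z) +
      ((N * f z + ?k^2 - deriv g z / 2) * v z + (deriv g z / 2 * v z + ?k * ?v')) * h z) / N) (at z)"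
    by simp
  also have "- (g z / 2) * h z * (?v' + ?k * v z) +
      ((N * f z + ?k^2 - deriv g z / 2) * v z + (deriv g z / 2 * v z + ?k * ?v')) * h z =
      T * (h z * (?v' + ?k * v z)) + N * (h z * f z * v z)"
    by (simp add: field_simps power2_eq_square)
  also have "(T * (h z * (?v' + ?k * v z)) + N * (h z * f z * v z)) / N =
      T * op_E n \<tau> p T U h v z + h z * f z * v z"
    using N_nonzero z by (simp add: op_E_def add_divide_distrib)
  finally show ?thesis
    by (rule has_field_derivative_transform_within_open[OF _ U(1) z]) (simp add: op_E_def)
qed

lemma op_D_op_E:
  assumes v: "v \<in> gle_solutions"
  shows "op_D T U h (op_E n \<tau> p T U h v) = v"
proof
  fix z
  show "op_D T U h (op_E n \<tau> p T U h v) z = v z"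
  proof (cases "z \<in> U")
    case True
    have "op_D T U h (op_E n \<tau> p T U h v) z = h z * h z * f z * v z"
      using True by (simp add: op_D_def DERIV_imp_deriv[OF op_E_deriv[OF v True]])
    then show ?thesis by (simp add: h_square_f[OF True])
  qed (use v in \<open>simp add: op_D_def solution_space_def\<close>)
qed

lemma op_E_in:
  assumes v: "v \<in> gle_solutions"
  shows "op_E n \<tau> p T U h v \<in> lame_solutions"
proof (rule solution_spaceI)
  let ?u = "op_E n \<tau> p T U h v"
  fix z assume z: "z \<in> U"
  show "(?u has_field_derivative T * ?u z + h z * f z * v z) (at z)" by (rule op_E_deriv[OF v z])
  have u: "N * ?u z = h z * (deriv v z + (T + g z / 2) * v z)"
    using z N_nonzero by (simp add: op_E_def)
  have "((\<lambda>z. T * ?u z + h z * f z * v z) has_field_derivative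
      T * (T * ?u z + h z * f z * v z) + (g z / 2 * (h z * f z) * v z + h z * f z * deriv v z)) (at z)"
    by (auto intro!: derivative_eq_intros h_deriv[OF z] f_deriv[OF z] gle_solution_derivs[OF v z]
        op_E_deriv[OF v z] simp: field_simps)
  also have "T * (T * ?u z + h z * f z * v z) + (g z / 2 * (h z * f z) * v z + h z * f z * deriv v z) =
      T^2 * ?u z + f z * (h z * (deriv v z + (T + g z / 2) * v z))"
    by (simp add: algebra_simps power2_eq_square)
  also have "\<dots> = lame_potential n (T^2 - N * wp \<tau> p) \<tau> z * ?u z"
    unfolding u[symmetric] by (simp add: lame_potential_def f_fun_def algebra_simps)
  finally show "((\<lambda>z. T * ?u z + h z * f z * v z) has_field_derivative
      lame_potential n (T^2 - N * wp \<tau> p) \<tau> z * ?u z) (at z)" .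
qed (simp add: op_E_def)

lemma deriv_linear_combination:
  assumes "y\<^sub>1 holomorphic_on U" "y\<^sub>2 holomorphic_on U" "z \<in> U"
  shows "deriv (\<lambda>z. a * y\<^sub>1 z + b * y\<^sub>2 z) z = a * deriv y\<^sub>1 z + b * deriv y\<^sub>2 z"
  by (rule DERIV_imp_deriv)
     (auto intro!: derivative_eq_intros holomorphic_derivI[OF assms(1) U(1) assms(3)]
        holomorphic_derivI[OF assms(2) U(1) assms(3)])

lemma op_D_linear: "complex_linear_on lame_solutions (op_D T U h)"
  unfolding complex_linear_on_def
  by (auto simp: op_D_def fun_eq_iff solution_space_def deriv_linear_combination algebra_simps)

lemma op_E_linear: "complex_linear_on gle_solutions (op_E n \<tau> p T U h)"
  unfolding complex_linear_on_def
proof (intro ballI allI ext)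
  fix y\<^sub>1 y\<^sub>2 a b z assume y: "y\<^sub>1 \<in> gle_solutions" "y\<^sub>2 \<in> gle_solutions"
  show "op_E n \<tau> p T U h (\<lambda>z. a * y\<^sub>1 z + b * y\<^sub>2 z) z =
      a * op_E n \<tau> p T U h y\<^sub>1 z + b * op_E n \<tau> p T U h y\<^sub>2 z"
  proof (cases "z \<in> U")
    case True
    have "deriv (\<lambda>z. a * y\<^sub>1 z + b * y\<^sub>2 z) z = a * deriv y\<^sub>1 z + b * deriv y\<^sub>2 z"
      using y by (intro deriv_linear_combination True) (simp_all add: solution_space_def)
    then show ?thesis using True by (simp add: op_E_def algebra_simps)
  qed (simp add: op_E_def)
qed

lemma isomorphisms:
  "mutually_inverse_isomorphisms lame_solutions gle_solutions (op_D T U h) (op_E n \<tau> p T U h)"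
  unfolding mutually_inverse_isomorphisms_def
  using op_D_in op_E_in op_D_linear op_E_linear op_E_op_D op_D_op_E by blast

end

section \<open>Analytic continuation and monodromy\<close>

lemma has_deriv_imp_constant_on_ball:
  fixes q :: "complex \<Rightarrow> complex"
  assumes "\<And>z. z \<in> ball a r \<Longrightarrow> (q has_field_derivative 0) (at z)"
  obtains c where "\<And>z. z \<in> ball a r \<Longrightarrow> q z = c"
proof -
  have "\<exists>c. \<forall>z\<in>ball a r. q z = c"
    by (rule has_field_derivative_zero_constant[OF convex_ball])
       (rule has_field_derivative_at_within[OF assms])
  then show ?thesis using that by blast
qed

lemma deriv_translate: "deriv (\<lambda>x. f (x + a)) z = deriv f (z + a)" for f :: "complex \<Rightarrow> complex"
proof -
  have "deriv f (z + a) = deriv (f \<circ> (+) (z + a)) 0" by (rule deriv_shift_0)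
  also have "f \<circ> (+) (z + a) = (\<lambda>x. f (x + a)) \<circ> (+) z" by (rule ext) (simp add: add_ac)
  also have "deriv \<dots> 0 = deriv (\<lambda>x. f (x + a)) z" by (rule deriv_shift_0[symmetric])
  finally show ?thesis ..
qed

lemma eventually_nhds_deriv_eq:
  fixes u v :: "complex \<Rightarrow> complex"
  assumes "\<forall>\<^sub>F z in nhds a. u z = v z"
  shows "\<forall>\<^sub>F z in nhds a. deriv u z = deriv v z"
proof -
  from assms have "\<forall>\<^sub>F z in nhds a. \<forall>\<^sub>F x in nhds z. u x = v x" by (simp add: eventually_eventually)
  then show ?thesis by eventually_elim (rule deriv_cong_ev[OF _ refl])
qed

lemma eventually_nhds_differentiable:
  assumes "f analytic_on {a :: complex}"
  shows "\<forall>\<^sub>F z in nhds a. f field_differentiable at z"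
proof -
  obtain S where S: "open S" "a \<in> S" "f holomorphic_on S" using assms by (auto simp: analytic_at)
  then have "\<forall>\<^sub>F z in nhds a. z \<in> S" by (intro eventually_nhds_in_open)
  then show ?thesis
    by eventually_elim (rule holomorphic_on_imp_differentiable_at[OF S(3,1)])
qed

text \<open>Regularity near the base point is thus contained in the continuation itself, so the
  monodromy lemma can be stated for arbitrary functions.\<close>

lemma continues_along_analytic_start:
  assumes "continues_along \<gamma> u u'"
  shows "u analytic_on {pathstart \<gamma>}"
proof -
  obtain F :: "real \<Rightarrow> complex \<Rightarrow> complex" where F: "F 0 analytic_on {\<gamma> 0}" "\<forall>\<^sub>F z in nhds (pathstart \<gamma>). F 0 z = u z"
    using assms unfolding continues_along_def by force
  then show ?thesis using analytic_at_cong[OF F(2)] by (simp add: pathstart_def)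
qed

lemma continues_along_cmult:
  assumes "continues_along \<gamma> u u'"
  shows "continues_along \<gamma> (\<lambda>z. c * u z) (\<lambda>z. c * u' z)"
proof -
  obtain F :: "real \<Rightarrow> complex \<Rightarrow> complex" where F: "\<forall>t\<in>{0..1}. F t analytic_on {\<gamma> t}"
    "\<forall>t\<in>{0..1}. \<exists>e>0. \<forall>s\<in>{0..1}. \<bar>s - t\<bar> < e \<longrightarrow> (\<forall>\<^sub>F z in nhds (\<gamma> s). F s z = F t z)"
    "\<forall>\<^sub>F z in nhds (pathstart \<gamma>). F 0 z = u z" "\<forall>\<^sub>F z in nhds (pathfinish \<gamma>). F 1 z = u' z"
    using assms unfolding continues_along_def by blast
  show ?thesis unfolding continues_along_def
  proof (intro exI[of _ "\<lambda>t z. c * F t z"] conjI ballI)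
    fix t :: real assume t: "t \<in> {0..1}"
    show "(\<lambda>z. c * F t z) analytic_on {\<gamma> t}" using F(1) t by (intro analytic_intros) auto
    obtain e where "e > 0" "\<forall>s\<in>{0..1}. \<bar>s - t\<bar> < e \<longrightarrow> (\<forall>\<^sub>F z in nhds (\<gamma> s). F s z = F t z)"
      using F(2) t by blast
    then show "\<exists>e>0. \<forall>s\<in>{0..1}. \<bar>s - t\<bar> < e \<longrightarrow> (\<forall>\<^sub>F z in nhds (\<gamma> s). c * F s z = c * F t z)"
      by (intro exI[of _ e]) (auto elim: eventually_mono)
  next
    show "\<forall>\<^sub>F z in nhds (pathstart \<gamma>). c * F 0 z = c * u z" using F(3) by eventually_elim simp
    show "\<forall>\<^sub>F z in nhds (pathfinish \<gamma>). c * F 1 z = c * u' z" using F(4) by eventually_elim simp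
  qed
qed

lemma continues_along_cong:
  assumes "continues_along \<gamma> u u'" "\<forall>\<^sub>F z in nhds (pathstart \<gamma>). u z = v z"
  shows "continues_along \<gamma> v u'"
proof -
  obtain F :: "real \<Rightarrow> complex \<Rightarrow> complex" where F: "\<forall>t\<in>{0..1}. F t analytic_on {\<gamma> t}"
    "\<forall>t\<in>{0..1}. \<exists>e>0. \<forall>s\<in>{0..1}. \<bar>s - t\<bar> < e \<longrightarrow> (\<forall>\<^sub>F z in nhds (\<gamma> s). F s z = F t z)"
    "\<forall>\<^sub>F z in nhds (pathstart \<gamma>). F 0 z = u z" "\<forall>\<^sub>F z in nhds (pathfinish \<gamma>). F 1 z = u' z"
    using assms(1) unfolding continues_along_def by blast
  from F(3) assms(2) have "\<forall>\<^sub>F z in nhds (pathstart \<gamma>). F 0 z = v z" by eventually_elim simp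
  with F show ?thesis unfolding continues_along_def by blast
qed

text \<open>Differentiation and products act on germs, and \<open>k\<close> is single-valued along
  the path, so applying the operator to each germ of the chain continues the image.\<close>

lemma continues_along_first_order:
  assumes u: "continues_along \<gamma> u u'" and h: "continues_along \<gamma> h h'"
    and k: "\<And>t. t \<in> {0..1} \<Longrightarrow> k analytic_on {\<gamma> t}"
  shows "continues_along \<gamma> (\<lambda>z. h z * (deriv u z + k z * u z)) (\<lambda>z. h' z * (deriv u' z + k z * u' z))"
proof -
  obtain F :: "real \<Rightarrow> complex \<Rightarrow> complex" where F: "\<forall>t\<in>{0..1}. F t analytic_on {\<gamma> t}"
    "\<forall>t\<in>{0..1}. \<exists>e>0. \<forall>s\<in>{0..1}. \<bar>s - t\<bar> < e \<longrightarrow> (\<forall>\<^sub>F z in nhds (\<gamma> s). F s z = F t z)"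
    "\<forall>\<^sub>F z in nhds (pathstart \<gamma>). F 0 z = u z" "\<forall>\<^sub>F z in nhds (pathfinish \<gamma>). F 1 z = u' z"
    using u unfolding continues_along_def by blast
  obtain H :: "real \<Rightarrow> complex \<Rightarrow> complex" where H: "\<forall>t\<in>{0..1}. H t analytic_on {\<gamma> t}"
    "\<forall>t\<in>{0..1}. \<exists>e>0. \<forall>s\<in>{0..1}. \<bar>s - t\<bar> < e \<longrightarrow> (\<forall>\<^sub>F z in nhds (\<gamma> s). H s z = H t z)"
    "\<forall>\<^sub>F z in nhds (pathstart \<gamma>). H 0 z = h z" "\<forall>\<^sub>F z in nhds (pathfinish \<gamma>). H 1 z = h' z"
    using h unfolding continues_along_def by blast
  define G where "G = (\<lambda>t z. H t z * (deriv (F t) z + k z * F t z))"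
  have cong: "\<forall>\<^sub>F z in nhds a. x z * (deriv y z + k z * y z) = x' z * (deriv y' z + k z * y' z)"
    if "\<forall>\<^sub>F z in nhds a. x z = x' z" "\<forall>\<^sub>F z in nhds a. y z = y' z" for a x x' y y'
    using that(1) that(2) eventually_nhds_deriv_eq[OF that(2)] by eventually_elim simp
  show ?thesis unfolding continues_along_def
  proof (intro exI[of _ G] conjI ballI)
    fix t :: real assume t: "t \<in> {0..1}"
    show "G t analytic_on {\<gamma> t}"
      unfolding G_def using F(1) H(1) k t by (intro analytic_intros analytic_deriv) auto
    obtain e\<^sub>1 where e1: "e\<^sub>1 > 0" "\<forall>s\<in>{0..1}. \<bar>s - t\<bar> < e\<^sub>1 \<longrightarrow> (\<forall>\<^sub>F z in nhds (\<gamma> s). F s z = F t z)"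
      using F(2) t by blast
    obtain e\<^sub>2 where e2: "e\<^sub>2 > 0" "\<forall>s\<in>{0..1}. \<bar>s - t\<bar> < e\<^sub>2 \<longrightarrow> (\<forall>\<^sub>F z in nhds (\<gamma> s). H s z = H t z)"
      using H(2) t by blast
    show "\<exists>e>0. \<forall>s\<in>{0..1}. \<bar>s - t\<bar> < e \<longrightarrow> (\<forall>\<^sub>F z in nhds (\<gamma> s). G s z = G t z)"
      unfolding G_def using e1 e2 by (intro exI[of _ "min e\<^sub>1 e\<^sub>2"] conjI ballI impI cong) auto
  next
    show "\<forall>\<^sub>F z in nhds (pathstart \<gamma>). G 0 z = h z * (deriv u z + k z * u z)"
      unfolding G_def by (rule cong[OF H(3) F(3)])
    show "\<forall>\<^sub>F z in nhds (pathfinish \<gamma>). G 1 z = h' z * (deriv u' z + k z * u' z)"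
      unfolding G_def by (rule cong[OF H(4) F(4)])
  qed
qed

text \<open>The common form of both operators. Such an operator commutes with continuation, and also
  with translation by \<omega> since \<open>k\<close> is periodic and \<open>h\<close> returns to
  itself; being linear, it lets the constant matrix pass through.\<close>

lemma monodromy_matrix_first_order:
  assumes M: "monodromy_matrix \<gamma> \<omega> Y M"
    and h: "continues_along \<gamma> h h'" "\<forall>\<^sub>F z in nhds (pathstart \<gamma>). h' (z + \<omega>) = h z"
    and k: "\<And>t. t \<in> {0..1} \<Longrightarrow> k analytic_on {\<gamma> t}" "\<And>z. k (z + \<omega>) = k z"
    and X: "\<And>i. \<forall>\<^sub>F z in nhds (pathstart \<gamma>). X i z = h z * (deriv (Y i) z + k z * Y i z)"
  shows "monodromy_matrix \<gamma> \<omega> X M"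
proof -
  obtain Y' where Y': "\<And>i. continues_along \<gamma> (Y i) (Y' i)"
    "\<forall>\<^sub>F z in nhds (pathstart \<gamma>). (\<chi> j. Y' j (z + \<omega>)) = (\<chi> i. Y i z) v* M"
    using M unfolding monodromy_matrix_def by blast
  have eq: "\<forall>\<^sub>F z in nhds (pathstart \<gamma>). Y' j (z + \<omega>) = (\<Sum>i\<in>UNIV. M $ i $ j * Y i z)" for j
    using Y'(2) by eventually_elim (simp add: vec_eq_iff vector_matrix_mult_def mult.commute)
  have deq: "\<forall>\<^sub>F z in nhds (pathstart \<gamma>). deriv (Y' j) (z + \<omega>) = (\<Sum>i\<in>UNIV. M $ i $ j * deriv (Y i) z)" for j
  proof -
    have "\<forall>\<^sub>F z in nhds (pathstart \<gamma>). \<forall>i. Y i field_differentiable at z"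
      by (intro eventually_all_finite eventually_nhds_differentiable continues_along_analytic_start[OF Y'(1)])
    with eventually_nhds_deriv_eq[OF eq[of j]] show ?thesis
    proof eventually_elim
      case (elim z)
      have "((\<lambda>z. \<Sum>i\<in>UNIV. M $ i $ j * Y i z) has_field_derivative (\<Sum>i\<in>UNIV. M $ i $ j * deriv (Y i) z)) (at z)"
        using elim(2) by (intro DERIV_sum DERIV_cmult field_differentiable_derivI) auto
      with elim(1) show ?case by (simp add: deriv_translate DERIV_imp_deriv)
    qed
  qed
  define X' where "X' = (\<lambda>j z. h' z * (deriv (Y' j) z + k z * Y' j z))"
  have cont: "continues_along \<gamma> (X i) (X' i)" for i
    unfolding X'_def using X[of i]
    by (intro continues_along_cong[OF continues_along_first_order[OF Y'(1) h(1) k(1)]])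
       (auto elim: eventually_mono)
  have "\<forall>\<^sub>F z in nhds (pathstart \<gamma>). \<forall>j. X' j (z + \<omega>) = (\<Sum>i\<in>UNIV. M $ i $ j * X i z)"
  proof (intro eventually_all_finite)
    fix j
    have "\<forall>\<^sub>F z in nhds (pathstart \<gamma>). \<forall>i. X i z = h z * (deriv (Y i) z + k z * Y i z)"
      by (intro eventually_all_finite X)
    with eq[of j] deq[of j] h(2)
    show "\<forall>\<^sub>F z in nhds (pathstart \<gamma>). X' j (z + \<omega>) = (\<Sum>i\<in>UNIV. M $ i $ j * X i z)"
      by eventually_elim
         (simp add: X'_def k(2) sum_distrib_left algebra_simps flip: sum.distrib)
  qed
  then have "\<forall>\<^sub>F z in nhds (pathstart \<gamma>). (\<chi> j. X' j (z + \<omega>)) = (\<chi> i. X i z) v* M"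
    by eventually_elim (simp add: vec_eq_iff vector_matrix_mult_def mult.commute)
  with cont show ?thesis unfolding monodromy_matrix_def by blast
qed

section \<open>The function \<open>\<Psi>\<close> has the logarithmic derivative of
  \<open>h\<close>\<close>

context generic_parameter
begin

lemma g_fun_periodic:
  assumes "\<alpha> \<in> lattice \<tau>"
  shows "g_fun \<tau> p (z + \<alpha>) = g_fun \<tau> p z"
proof -
  have "f_fun \<tau> p (w + \<alpha>) = f_fun \<tau> p w" for w by (simp add: f_fun_def wp_periodic[OF assms])
  then show ?thesis by (simp add: g_fun_def deriv_periodic)
qed

lemma wsigma_translate_deriv:
  assumes "z + a \<notin> lattice \<tau>"
  shows "((\<lambda>x. wsigma \<tau> (x + a)) has_field_derivative wzeta \<tau> (z + a) * wsigma \<tau> (z + a)) (at z)"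
proof -
  have "((\<lambda>x. wsigma \<tau> (x + a)) has_field_derivative wzeta \<tau> (z + a) * wsigma \<tau> (z + a) * 1) (at z)"
    by (rule DERIV_chain2[where g = "\<lambda>x. x + a"])
       (auto intro!: derivative_eq_intros wsigma_deriv[OF assms])
  then show ?thesis by simp
qed

text \<open>Sigma has logarithmic derivative zeta and the square root halves, which gives
  \<open>\<zeta>(z) - (\<zeta>(z - p) + \<zeta>(z + p)) / 2\<close>. The zeta formula identifies
  this with \<open>- g / 2\<close>.\<close>

lemma Psi_branch_deriv:
  assumes \<psi>: "Psi_branch \<tau> p W \<psi>" and W: "open W" and z: "z \<in> W" "z \<notin> singular_points \<tau> p"
  shows "(\<psi> has_field_derivative - (g_fun \<tau> p z / 2) * \<psi> z) (at z)" and "\<psi> z \<noteq> 0"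
proof -
  obtain r where r: "r holomorphic_on W" "\<And>z. z \<in> W \<Longrightarrow> r z ^ 2 = wsigma \<tau> (z - p) * wsigma \<tau> (z + p)"
      "\<And>z. z \<in> W \<Longrightarrow> \<psi> z = wsigma \<tau> z / r z"
    using \<psi> by (auto simp: Psi_branch_def)
  note ns = nonsingularD[OF z(2)]
  have rz: "r z ^ 2 \<noteq> 0" using r(2)[OF z(1)] ns by (simp add: wsigma_nonzero)
  then have r0: "r z \<noteq> 0" by simp
  show "\<psi> z \<noteq> 0" using r(3)[OF z(1)] r0 ns by (simp add: wsigma_nonzero)
  have r': "(r has_field_derivative deriv r z) (at z)" by (rule holomorphic_derivI[OF r(1) W z(1)])
  define s where "s = wzeta \<tau> (z - p) + wzeta \<tau> (z + p)"
  have "((\<lambda>w. wsigma \<tau> (w - p) * wsigma \<tau> (w + p)) has_field_derivative s * r z ^ 2) (at z)"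
    unfolding r(2)[OF z(1)] s_def
    using DERIV_mult[OF wsigma_translate_deriv[of z "- p"] wsigma_translate_deriv[of z p]] ns
    by (simp add: algebra_simps)
  moreover have "((\<lambda>w. wsigma \<tau> (w - p) * wsigma \<tau> (w + p)) has_field_derivative 2 * r z * deriv r z) (at z)"
    by (rule has_field_derivative_transform_within_open[OF _ W z(1), where f = "\<lambda>w. r w ^ 2"])
       (auto intro!: derivative_eq_intros r' simp: r(2))
  ultimately have "s * r z ^ 2 = 2 * r z * deriv r z" by (rule DERIV_unique)
  then have dr: "deriv r z = s * r z / 2" using r0 by (simp add: power2_eq_square)
  have "(wzeta \<tau> z * wsigma \<tau> z * r z - wsigma \<tau> z * (s * r z / 2)) / (r z * r z) =
      (wzeta \<tau> z - s / 2) * (wsigma \<tau> z / r z)"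
    using r0 by (simp add: field_simps)
  with DERIV_divide[OF wsigma_deriv[OF ns(1)] r' r0]
  have "((\<lambda>w. wsigma \<tau> w / r w) has_field_derivative (wzeta \<tau> z - s / 2) * (wsigma \<tau> z / r z)) (at z)"
    unfolding dr by simp
  then have "(\<psi> has_field_derivative (wzeta \<tau> z - s / 2) * \<psi> z) (at z)"
    unfolding r(3)[OF z(1)]
    by (rule has_field_derivative_transform_within_open[OF _ W z(1)]) (simp add: r(3))
  also have "wzeta \<tau> z - s / 2 = - (g_fun \<tau> p z / 2)"
    by (simp add: g_fun_eq_zeta[OF z(2)] s_def field_simps)
  finally show "(\<psi> has_field_derivative - (g_fun \<tau> p z / 2) * \<psi> z) (at z)" .
qed

end

section \<open>Monodromy of the two operators\<close>

context branch_data
begin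

text \<open>\<open>h\<close> is given only on \<open>U\<close>, which the cycle may leave. Near the
  base point it is a nonzero constant multiple of \<psi>, so the same multiple of the continuation
  of \<psi> continues \<open>h\<close> and inherits its return to itself.\<close>

lemma h_continues_along:
  assumes \<gamma>: "admissible_cycle \<tau> p \<omega> \<gamma>" "pathstart \<gamma> \<in> U"
  obtains h' where "continues_along \<gamma> h h'" "\<forall>\<^sub>F z in nhds (pathstart \<gamma>). h' (z + \<omega>) = h z"
proof -
  obtain W \<psi> \<psi>' where W: "open W" "pathstart \<gamma> \<in> W" "Psi_branch \<tau> p W \<psi>"
      "continues_along \<gamma> \<psi> \<psi>'" "\<forall>\<^sub>F z in nhds (pathstart \<gamma>). \<psi>' (z + \<omega>) = \<psi> z"
    using \<gamma>(1) unfolding admissible_cycle_def by blast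
  obtain r where r: "r > 0" "ball (pathstart \<gamma>) r \<subseteq> U \<inter> W"
    using open_contains_ball[of "U \<inter> W"] U(1) W(1,2) \<gamma>(2) by blast
  have "((\<lambda>z. \<psi> z / h z) has_field_derivative 0) (at z)" if "z \<in> ball (pathstart \<gamma>) r" for z
  proof -
    have z: "z \<in> U" "z \<in> W" using that r(2) by auto
    have "h z \<noteq> 0" using h_square_f[OF z(1)] by auto
    from DERIV_divide[OF Psi_branch_deriv(1)[OF W(3,1) z(2) nonsingular[OF z(1)]] h_deriv[OF z(1)] this]
    show ?thesis by (simp add: algebra_simps)
  qed
  then obtain c where c: "\<And>z. z \<in> ball (pathstart \<gamma>) r \<Longrightarrow> \<psi> z / h z = c"
    using has_deriv_imp_constant_on_ball[of "pathstart \<gamma>" r "\<lambda>z. \<psi> z / h z"] by blast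
  have "\<psi> (pathstart \<gamma>) \<noteq> 0" "h (pathstart \<gamma>) \<noteq> 0"
    using Psi_branch_deriv(2)[OF W(3,1,2) nonsingular[OF \<gamma>(2)]] h_square_f[OF \<gamma>(2)] by auto
  then have c0: "c \<noteq> 0" using c[of "pathstart \<gamma>"] r(1) by auto
  have "\<forall>\<^sub>F z in nhds (pathstart \<gamma>). z \<in> ball (pathstart \<gamma>) r"
    using r(1) by (intro eventually_nhds_in_open) auto
  then have eq: "\<forall>\<^sub>F z in nhds (pathstart \<gamma>). inverse c * \<psi> z = h z"
  proof eventually_elim
    case (elim z)
    have "h z \<noteq> 0" using h_square_f[of z] elim r(2) by auto
    then have "\<psi> z = c * h z" using c[OF elim] by (simp add: field_simps)
    then show ?case using c0 by simp
  qed
  show ?thesis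
  proof
    show "continues_along \<gamma> h (\<lambda>z. inverse c * \<psi>' z)"
      by (rule continues_along_cong[OF continues_along_cmult[OF W(4)] eq])
    show "\<forall>\<^sub>F z in nhds (pathstart \<gamma>). inverse c * \<psi>' (z + \<omega>) = h z"
      using W(5) eq by eventually_elim simp
  qed
qed

context
  fixes \<omega> \<gamma>
  assumes \<gamma>: "admissible_cycle \<tau> p \<omega> \<gamma>" "pathstart \<gamma> \<in> U" and \<omega>: "\<omega> \<in> lattice \<tau>"
begin

lemma path_nonsingular: "t \<in> {0..1} \<Longrightarrow> \<gamma> t \<notin> singular_points \<tau> p"
  using \<gamma>(1) unfolding admissible_cycle_def path_image_def by blast

lemma eventually_in_U: "\<forall>\<^sub>F z in nhds (pathstart \<gamma>). z \<in> U"
  using U(1) \<gamma>(2) by (rule eventually_nhds_in_open)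

lemma monodromy_matrix_op_D:
  assumes "monodromy_matrix \<gamma> \<omega> Y M"
  shows "monodromy_matrix \<gamma> \<omega> (\<lambda>i. op_D T U h (Y i)) M"
proof -
  obtain h' where h': "continues_along \<gamma> h h'" "\<forall>\<^sub>F z in nhds (pathstart \<gamma>). h' (z + \<omega>) = h z"
    by (rule h_continues_along[OF \<gamma>])
  show ?thesis
  proof (rule monodromy_matrix_first_order[OF assms h', where k = "\<lambda>_. - T"])
    fix i
    show "\<forall>\<^sub>F z in nhds (pathstart \<gamma>). op_D T U h (Y i) z = h z * (deriv (Y i) z + - T * Y i z)"
      using eventually_in_U by eventually_elim (simp add: op_D_def)
  qed auto
qed

lemma monodromy_matrix_op_E:
  assumes "monodromy_matrix \<gamma> \<omega> Y M"
  shows "monodromy_matrix \<gamma> \<omega> (\<lambda>i. op_E n \<tau> p T U h (Y i)) M"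
proof -
  obtain h' where h': "continues_along \<gamma> h h'" "\<forall>\<^sub>F z in nhds (pathstart \<gamma>). h' (z + \<omega>) = h z"
    by (rule h_continues_along[OF \<gamma>])
  \<comment> \<open>The factor \<open>1/N\<close> is absorbed into \<open>h\<close> to reach the
    common first-order form.\<close>
  have h'': "\<forall>\<^sub>F z in nhds (pathstart \<gamma>). inverse N * h' (z + \<omega>) = inverse N * h z"
    using h'(2) by eventually_elim simp
  show ?thesis
  proof (rule monodromy_matrix_first_order[OF assms continues_along_cmult[OF h'(1)] h'',
        where k = "\<lambda>z. T + g z / 2"])
    fix i
    show "\<forall>\<^sub>F z in nhds (pathstart \<gamma>). op_E n \<tau> p T U h (Y i) z =
        inverse N * h z * (deriv (Y i) z + (T + g z / 2) * Y i z)"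
      using eventually_in_U by eventually_elim (simp only: op_E_def if_True divide_inverse mult.commute[of "inverse N"])
  next
    fix t :: real assume "t \<in> {0..1}"
    then show "(\<lambda>z. T + g z / 2) analytic_on {\<gamma> t}"
      by (intro analytic_intros g_fun_analytic path_nonsingular) auto
  next
    show "T + g (z + \<omega>) / 2 = T + g z / 2" for z by (simp add: g_fun_periodic[OF \<omega>])
  qed
qed

end

lemma period_in_lattice: "\<omega> \<in> {1, \<tau>} \<Longrightarrow> \<omega> \<in> lattice \<tau>"
  using lattice_1 lattice_tau by auto

lemma op_D_preserves_period_monodromy:
  "preserves_period_monodromy \<tau> p U lame_solutions (op_D T U h)"
  unfolding preserves_period_monodromy_def
proof (intro allI impI ballI iffI; elim conjE)
  fix Y \<omega> \<gamma> M
  assume Y: "fundamental_system lame_solutions Y" and \<omega>: "\<omega> \<in> {1, \<tau>}"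
    and \<gamma>: "admissible_cycle \<tau> p \<omega> \<gamma>" "pathstart \<gamma> \<in> U"
  note \<omega>' = period_in_lattice[OF \<omega>]
  show "monodromy_matrix \<gamma> \<omega> (\<lambda>i. op_D T U h (Y i)) M" if "monodromy_matrix \<gamma> \<omega> Y M"
    by (rule monodromy_matrix_op_D[OF \<gamma> \<omega>' that])
  \<comment> \<open>For the converse the inverse operator is applied to the image system and returns
    the original one.\<close>
  assume "monodromy_matrix \<gamma> \<omega> (\<lambda>i. op_D T U h (Y i)) M"
  from monodromy_matrix_op_E[OF \<gamma> \<omega>' this] show "monodromy_matrix \<gamma> \<omega> Y M"
    using Y by (simp add: fundamental_system_def op_E_op_D)
qed

lemma op_E_preserves_period_monodromy:
  "preserves_period_monodromy \<tau> p U gle_solutions (op_E n \<tau> p T U h)"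
  unfolding preserves_period_monodromy_def
proof (intro allI impI ballI iffI; elim conjE)
  fix Y \<omega> \<gamma> M
  assume Y: "fundamental_system gle_solutions Y" and \<omega>: "\<omega> \<in> {1, \<tau>}"
    and \<gamma>: "admissible_cycle \<tau> p \<omega> \<gamma>" "pathstart \<gamma> \<in> U"
  note \<omega>' = period_in_lattice[OF \<omega>]
  show "monodromy_matrix \<gamma> \<omega> (\<lambda>i. op_E n \<tau> p T U h (Y i)) M" if "monodromy_matrix \<gamma> \<omega> Y M"
    by (rule monodromy_matrix_op_E[OF \<gamma> \<omega>' that])
  assume "monodromy_matrix \<gamma> \<omega> (\<lambda>i. op_E n \<tau> p T U h (Y i)) M"
  from monodromy_matrix_op_D[OF \<gamma> \<omega>' this] show "monodromy_matrix \<gamma> \<omega> Y M"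
    using Y by (simp add: fundamental_system_def op_D_op_E)
qed

end

theorem proposition7p4:
  fixes n :: nat and \<tau> p T :: complex and U :: "complex set" and h :: "complex \<Rightarrow> complex"
  assumes "n \<ge> 1" and "Im \<tau> > 0" and "2 * p \<notin> lattice \<tau>"
    and "open U" and "connected U" and "U \<inter> singular_points \<tau> p = {}"
    and "h_branch \<tau> p U h"
  shows "mutually_inverse_isomorphisms
           (solution_space (lame_potential n (T^2 - of_nat (n * (n + 1)) * wp \<tau> p) \<tau>) U)
           (solution_space (gle_potential n p T \<tau>) U)
           (op_D T U h) (op_E n \<tau> p T U h) \<and>
         preserves_period_monodromy \<tau> p U
           (solution_space (lame_potential n (T^2 - of_nat (n * (n + 1)) * wp \<tau> p) \<tau>) U)
           (op_D T U h) \<and>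
         preserves_period_monodromy \<tau> p U
           (solution_space (gle_potential n p T \<tau>) U)
           (op_E n \<tau> p T U h)"
proof -
  interpret branch_data \<tau> p n T U h
    using assms by unfold_locales auto
  show ?thesis
    using isomorphisms op_D_preserves_period_monodromy op_E_preserves_period_monodromy by blast
qed

end
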